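(* Let $V$ be a finite-dimensional Euclidean vector space. A subalgebra $A\subset\mathbb{R}[V]$ is of the form $A=\mathbb{R}[V]^\Gamma$ for a finite group $\Gamma\subset\mathrm{O}(V)$ if and only if $A$ is maximal, Laplacian, and its field of fractions has transcendence degree over $\mathbb{R}$ equal to $\dim V$.
   Context: $\mathbb{R}[V]=\mathbb{R}[x_1,\dots,x_n]$ for an orthonormal basis $x_1,\dots,x_n$ of $V^*$; $\mathbb{S}(V)$ is the unit sphere of $V$. A subalgebra $A\subseteq\mathbb{R}[V]$ is Laplacian if $r^2:=\sum_i x_i^2\in A$ and $\Delta f=\sum_i\partial^2 f/\partial x_i^2\in A$ for every $f\in A$. For a subalgebra $A\subset\mathbb{R}[V]$, let $\sim_A$ be the equivalence relation on $\mathbb{S}(V)$ with $p\sim_A q$ iff $f(p)=f(q)$ for all $f\in A$. $A$ is maximal if for every homogeneous polynomial $f\in\mathbb{R}[V]$ with $f\notin A$ there exist $p,q\in\mathbb{S}(V)$ with $p\sim_A q$ and $f(p)\neq f(q)$. *)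

theory Defs
  imports
    "HOL-Analysis.Analysis"
    "HOL-Computational_Algebra.Fraction_Field"
    "HOL-Library.Poly_Mapping"
    "HOL-Algebra.Group"
begin

section \<open>The ring of polynomial functions on a Euclidean space\<close>

text \<open>
  The ground field is infinite, so \<open>\<real>[V]\<close> is the ring of real polynomial functions on \<open>V\<close>,
  i.e. the algebra of functions generated by the linear functionals. It is made into a type,
  and that type into an integral domain, so that \<^typ>\<open>'a fract\<close> is available on it.
\<close>

typedef (overloaded) ('a::real_normed_vector) polyfun =
  "{f :: 'a \<Rightarrow> real. real_polynomial_function f}"
  morphisms polyfun_apply Abs_polyfun
  by (auto intro: real_polynomial_function.intros(2))

setup_lifting type_definition_polyfun

lemma polyfun_eqI: "(\<And>x. polyfun_apply f x = polyfun_apply g x) \<Longrightarrow> f = g"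
  by (metis ext polyfun_apply_inject)

lemma real_polynomial_function_polyfun_apply: "real_polynomial_function (polyfun_apply f)"
  using polyfun_apply by auto

lemma real_polynomial_function_on_line:
  assumes "real_polynomial_function f"
  shows "\<exists>p :: real poly. \<forall>t. f (x + t *\<^sub>R v) = poly p t"
  using assms
proof induction
  case (linear f)
  then have "f (x + t *\<^sub>R v) = poly [:f x, f v:] t" for t
    using linear_simps(1)[OF linear] linear_simps(5)[OF linear] by simp
  then show ?case by blast
next
  case (const c)
  have "c = poly [:c:] t" for t
    by simp
  then show ?case by blast
next
  case (add f g)
  then show ?case
    by (metis poly_add)
next
  case (mult f g)
  then show ?case
    by (metis poly_mult)
qed

lemma real_polynomial_function_no_zero_divisors:
  assumes "real_polynomial_function f" "real_polynomial_function g"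
    and "f x \<noteq> 0" "g y \<noteq> 0"
  shows "\<exists>z. f z * g z \<noteq> 0"
proof -
  obtain p where p: "\<And>t. f (x + t *\<^sub>R (y - x)) = poly p t"
    using real_polynomial_function_on_line[OF assms(1)] by metis
  obtain q where q: "\<And>t. g (x + t *\<^sub>R (y - x)) = poly q t"
    using real_polynomial_function_on_line[OF assms(2)] by metis
  have "p \<noteq> 0"
    using p[of 0] assms(3) by auto
  moreover have "q \<noteq> 0"
    using q[of 1] assms(4) by auto
  ultimately have "p * q \<noteq> 0"
    by simp
  then obtain t where "poly (p * q) t \<noteq> 0"
    using poly_all_0_iff_0 by blast
  then show ?thesis
    using p q by (metis poly_mult)
qed

instantiation polyfun :: (real_normed_vector) "{idom, real_algebra_1}"
begin

lift_definition zero_polyfun :: "'a polyfun" is "\<lambda>_. 0"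
  by (rule real_polynomial_function.intros(2))

lift_definition one_polyfun :: "'a polyfun" is "\<lambda>_. 1"
  by (rule real_polynomial_function.intros(2))

lift_definition plus_polyfun :: "'a polyfun \<Rightarrow> 'a polyfun \<Rightarrow> 'a polyfun"
  is "\<lambda>f g x. f x + g x"
  by (rule real_polynomial_function.intros(3))

lift_definition uminus_polyfun :: "'a polyfun \<Rightarrow> 'a polyfun" is "\<lambda>f x. - f x"
  by (rule real_polynomial_function_minus)

lift_definition minus_polyfun :: "'a polyfun \<Rightarrow> 'a polyfun \<Rightarrow> 'a polyfun"
  is "\<lambda>f g x. f x - g x"
  by (rule real_polynomial_function_diff)

lift_definition times_polyfun :: "'a polyfun \<Rightarrow> 'a polyfun \<Rightarrow> 'a polyfun"
  is "\<lambda>f g x. f x * g x"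
  by (rule real_polynomial_function.intros(4))

lift_definition scaleR_polyfun :: "real \<Rightarrow> 'a polyfun \<Rightarrow> 'a polyfun" is "\<lambda>c f x. c * f x"
  by (intro real_polynomial_function.intros(4) real_polynomial_function.intros(2))

instance
proof
  fix f g :: "'a polyfun"
  assume "f \<noteq> 0" "g \<noteq> 0"
  then show "f * g \<noteq> 0"
  proof transfer
    fix f g :: "'a \<Rightarrow> real"
    assume *: "real_polynomial_function f" "real_polynomial_function g"
      and "f \<noteq> (\<lambda>_. 0)" "g \<noteq> (\<lambda>_. 0)"
    then obtain x y where "f x \<noteq> 0" "g y \<noteq> 0"
      by (metis ext)
    then show "(\<lambda>x. f x * g x) \<noteq> (\<lambda>_. 0)"
      using real_polynomial_function_no_zero_divisors[OF *] by meson
  qed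
qed (transfer; auto simp: algebra_simps fun_eq_iff)+

end

lemma real_polynomial_function_directional_derivative:
  assumes "real_polynomial_function f"
  shows "f differentiable (at x) \<and>
    real_polynomial_function (\<lambda>x. frechet_derivative f (at x) v)"
proof -
  have "\<exists>D. (\<forall>x. (f has_derivative D x) (at x)) \<and> real_polynomial_function (\<lambda>x. D x v)"
    using assms
  proof induction
    case (linear f)
    then show ?case
      by (intro exI[of _ "\<lambda>_. f"])
        (auto intro: bounded_linear_imp_has_derivative real_polynomial_function.intros(2))
  next
    case (const c)
    show ?case
      by (intro exI[of _ "\<lambda>_ _. 0"]) (auto intro: real_polynomial_function.intros(2))
  next
    case (add f g)
    then obtain D E where
      "\<And>x. (f has_derivative D x) (at x)" "real_polynomial_function (\<lambda>x. D x v)"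
      "\<And>x. (g has_derivative E x) (at x)" "real_polynomial_function (\<lambda>x. E x v)"
      by auto
    then show ?case
      by (intro exI[of _ "\<lambda>x h. D x h + E x h"])
        (auto intro: has_derivative_add real_polynomial_function.intros(3))
  next
    case (mult f g)
    then obtain D E where
      "\<And>x. (f has_derivative D x) (at x)" "real_polynomial_function (\<lambda>x. D x v)"
      "\<And>x. (g has_derivative E x) (at x)" "real_polynomial_function (\<lambda>x. E x v)"
      by auto
    then show ?case
      using mult.hyps
      by (intro exI[of _ "\<lambda>x h. f x * E x h + D x h * g x"])
        (auto intro: has_derivative_mult real_polynomial_function.intros(3) real_polynomial_function.intros(4))
  qed
  then obtain D where D: "\<And>x. (f has_derivative D x) (at x)" "real_polynomial_function (\<lambda>x. D x v)"
    by auto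
  then have "frechet_derivative f (at x) = D x" for x
    using frechet_derivative_at by metis
  then show ?thesis
    using D by (auto simp: differentiable_def)
qed

lift_definition directional_derivative ::
    "'a::real_normed_vector \<Rightarrow> 'a polyfun \<Rightarrow> 'a polyfun"
  is "\<lambda>v f x. frechet_derivative f (at x) v"
  using real_polynomial_function_directional_derivative by blast

lift_definition linear_coordinate :: "'a::real_inner \<Rightarrow> 'a polyfun"
  is "\<lambda>v x. v \<bullet> x"
  by (intro real_polynomial_function.intros(1) bounded_linear_inner_right)

definition laplacian :: "'a::euclidean_space polyfun \<Rightarrow> 'a polyfun" where
  "laplacian f = (\<Sum>b\<in>Basis. directional_derivative b (directional_derivative b f))"

definition radius_squared :: "'a::euclidean_space polyfun" where
  "radius_squared = (\<Sum>b\<in>Basis. (linear_coordinate b)\<^sup>2)"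

definition homogeneous :: "nat \<Rightarrow> 'a::real_normed_vector polyfun \<Rightarrow> bool" where
  "homogeneous d f \<longleftrightarrow> (\<forall>c x. polyfun_apply f (c *\<^sub>R x) = c ^ d * polyfun_apply f x)"


section \<open>Subalgebras\<close>

definition subalgebra :: "'b::real_algebra_1 set \<Rightarrow> bool" where
  "subalgebra A \<longleftrightarrow> subspace A \<and> 1 \<in> A \<and> (\<forall>f\<in>A. \<forall>g\<in>A. f * g \<in> A)"

definition laplacian_algebra :: "'a::euclidean_space polyfun set \<Rightarrow> bool" where
  "laplacian_algebra A \<longleftrightarrow> subalgebra A \<and> radius_squared \<in> A \<and> (\<forall>f\<in>A. laplacian f \<in> A)"

definition sphere_equiv :: "'a::real_normed_vector polyfun set \<Rightarrow> 'a \<Rightarrow> 'a \<Rightarrow> bool" where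
  "sphere_equiv A p q \<longleftrightarrow> p \<in> sphere 0 1 \<and> q \<in> sphere 0 1 \<and>
     (\<forall>f\<in>A. polyfun_apply f p = polyfun_apply f q)"

definition maximal_algebra :: "'a::real_normed_vector polyfun set \<Rightarrow> bool" where
  "maximal_algebra A \<longleftrightarrow> subalgebra A \<and>
     (\<forall>d f. homogeneous d f \<and> f \<notin> A \<longrightarrow>
       (\<exists>p q. sphere_equiv A p q \<and> polyfun_apply f p \<noteq> polyfun_apply f q))"


section \<open>Orthogonal group and invariants\<close>

definition orthogonal_group :: "('a::real_inner \<Rightarrow> 'a) monoid" where
  "orthogonal_group = \<lparr>carrier = {g. orthogonal_transformation g}, mult = (\<circ>), one = id\<rparr>"

lemma group_orthogonal_group: "group (orthogonal_group :: ('a::euclidean_space \<Rightarrow> 'a) monoid)"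
proof (rule groupI)
  fix g :: "'a \<Rightarrow> 'a"
  assume "g \<in> carrier orthogonal_group"
  then have g: "orthogonal_transformation g"
    by (simp add: orthogonal_group_def)
  have "inv_into UNIV g \<circ> g = id"
    using orthogonal_transformation_inj[OF g] by (rule inv_o_cancel)
  then show "\<exists>h\<in>carrier orthogonal_group. h \<otimes>\<^bsub>orthogonal_group\<^esub> g = \<one>\<^bsub>orthogonal_group\<^esub>"
    using orthogonal_transformation_inv[OF g] by (auto simp: orthogonal_group_def)
qed (auto simp: orthogonal_group_def id_def orthogonal_transformation_compose o_assoc)

definition invariant_ring :: "('a \<Rightarrow> 'a) set \<Rightarrow> 'a::real_normed_vector polyfun set" where
  "invariant_ring G = {f. \<forall>g\<in>G. \<forall>x. polyfun_apply f (g x) = polyfun_apply f x}"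


section \<open>Field of fractions and transcendence degree\<close>

definition fraction_field :: "'b::idom set \<Rightarrow> 'b fract set" where
  "fraction_field A = {Fract f g | f g. f \<in> A \<and> g \<in> A \<and> g \<noteq> 0}"

definition fract_of_real :: "real \<Rightarrow> 'b::{idom, real_algebra_1} fract" where
  "fract_of_real c = Fract (of_real c) 1"

text \<open>
  A real polynomial in commuting indeterminates indexed by a type \<open>'k\<close> is a finitely supported
  function from monomials (themselves finitely supported functions \<open>'k \<Rightarrow> nat\<close>) to \<open>\<real>\<close>.
  Below, the elements of \<open>S\<close> serve as names of the indeterminates, each of which is
  evaluated at itself.
\<close>

definition insertion_self :: "(('b::{idom, real_algebra_1} fract \<Rightarrow>\<^sub>0 nat) \<Rightarrow>\<^sub>0 real) \<Rightarrow> 'b fract" where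
  "insertion_self P = (\<Sum>m\<in>Poly_Mapping.keys P. fract_of_real (Poly_Mapping.lookup P m) *
      (\<Prod>s\<in>Poly_Mapping.keys m. s ^ Poly_Mapping.lookup m s))"

definition algebraically_independent :: "'b::{idom, real_algebra_1} fract set \<Rightarrow> bool" where
  "algebraically_independent S \<longleftrightarrow>
     (\<forall>P. (\<forall>m\<in>Poly_Mapping.keys P. Poly_Mapping.keys m \<subseteq> S) \<and> insertion_self P = 0 \<longrightarrow> P = 0)"

definition transcendence_basis :: "'b::{idom, real_algebra_1} fract set \<Rightarrow> 'b fract set \<Rightarrow> bool" where
  "transcendence_basis K B \<longleftrightarrow> B \<subseteq> K \<and> algebraically_independent B \<and>
     (\<forall>C. B \<subseteq> C \<and> C \<subseteq> K \<and> algebraically_independent C \<longrightarrow> C = B)"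

text \<open>
  A relation rather than a function, since \<^const>\<open>card\<close> gives \<open>0\<close> on infinite bases.
\<close>

definition has_transcendence_degree :: "'b::{idom, real_algebra_1} fract set \<Rightarrow> nat \<Rightarrow> bool" where
  "has_transcendence_degree K d \<longleftrightarrow> (\<exists>B. transcendence_basis K B \<and> finite B \<and> card B = d)"

end

theory Submission
  imports Defs "HOL-Computational_Algebra.Polynomial_Factorial"
begin

text \<open>
  Suppose first that \<open>A\<close> is the invariant ring of a finite orthogonal group \<open>\<Gamma>\<close>. It is Laplacian because
  the Laplacian commutes with isometries, and maximal because a homogeneous polynomial that is not
  invariant already differs at two points of one \<open>\<Gamma>\<close>-orbit on the sphere. For the transcendence
  degree, averaging over \<open>\<Gamma>\<close> produces invariants that are local coordinates at a point with trivial
  stabilizer (\<open>invariant_local_coordinates\<close>). Their lowest-order terms at that point are distinct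
  monomials, so they are algebraically independent (\<open>monomials_independent\<close>), and no larger
  independent family exists because \<open>n + 1\<close> polynomials in \<open>n\<close> variables have more monomials of
  bounded degree than the polynomials of that degree have room for
  (\<open>polynomial_relation_by_counting\<close>).

  Suppose conversely that \<open>A\<close> is maximal, Laplacian and of full transcendence degree. The identity
  \<open>\<Delta>(fg) = f \<Delta>g + g \<Delta>f + 2 \<langle>\<nabla>f, \<nabla>g\<rangle>\<close> shows that \<open>A\<close> contains all products \<open>\<langle>\<nabla>f, \<nabla>g\<rangle>\<close> with
  \<open>f, g \<in> A\<close>, and hence, taking \<open>g = r\<^sup>2\<close>, is stable under the Euler operator and graded. Call a point
  regular if the gradients of elements of \<open>A\<close> at that point fill the whole space. Full transcendence
  degree makes every coordinate function algebraic over \<open>A\<close>; differentiating a relation of least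
  degree shows that the points outside the zero set of a suitable nonzero homogeneous polynomial are
  regular (\<open>homogeneous_regular_where_nonzero\<close>).

  Let \<open>\<Gamma>\<close> consist of the orthogonal maps that fix every element of \<open>A\<close>. If \<open>p\<close> is regular and \<open>A\<close> does
  not distinguish \<open>p\<close> from \<open>q\<close>, then the gradients at \<open>p\<close> and \<open>q\<close> have the same Gram matrices, so some
  isometry \<open>g\<close> sends \<open>\<nabla>f(p)\<close> to \<open>\<nabla>f(q)\<close> for all \<open>f \<in> A\<close>. Since the gradient of \<open>r\<^sup>2\<close> is twice the
  position vector, \<open>g p = q\<close>. The defects \<open>f \<circ> g - f\<close> vanish to second order at \<open>p\<close>, and a Koszul-type
  argument raises this order indefinitely (\<open>isometry_defect_vanishing\<close>); so \<open>g \<in> \<Gamma>\<close>, and the fibres of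
  \<open>A\<close> through regular points are orbits of \<open>\<Gamma>\<close> (\<open>regular_fibre\<close>). These fibres are compact and
  discrete, which makes \<open>\<Gamma>\<close> finite.

  It remains to see that every homogeneous \<open>\<Gamma>\<close>-invariant \<open>f\<close> lies in \<open>A\<close>. Choose a nonzero homogeneous
  \<open>\<Gamma>\<close>-invariant \<open>w\<close> that vanishes at all points that are not regular (\<open>symmetric_weight\<close>): then \<open>w\<close> and \<open>w f\<close> are constant on all fibres, hence
  belong to \<open>A\<close> by maximality. Finally \<open>A\<close> is closed under division (\<open>laplacian_algebra_division\<close>):
  for the Fischer inner product, multiplication by \<open>w\<close> is adjoint to the differential operator
  \<open>w(\<partial>)\<close>, which preserves \<open>A\<close>; so if \<open>h\<close> is the component of \<open>f\<close> orthogonal to \<open>A\<close>, then \<open>w h\<close> lies in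
  \<open>A\<close> and is orthogonal to \<open>A\<close>, whence \<open>h = 0\<close>.
\<close>

section \<open>Differential calculus on polynomial functions\<close>

abbreviation ev :: "'a::real_normed_vector polyfun \<Rightarrow> 'a \<Rightarrow> real" where
  "ev \<equiv> polyfun_apply"

abbreviation D :: "'a::real_normed_vector \<Rightarrow> 'a polyfun \<Rightarrow> 'a polyfun" where
  "D \<equiv> directional_derivative"

abbreviation lin :: "'a::real_inner \<Rightarrow> 'a polyfun" where
  "lin \<equiv> linear_coordinate"

lemmas ev_simps [simp] =
  zero_polyfun.rep_eq one_polyfun.rep_eq plus_polyfun.rep_eq uminus_polyfun.rep_eq
  minus_polyfun.rep_eq times_polyfun.rep_eq scaleR_polyfun.rep_eq linear_coordinate.rep_eq

lemma ev_sum [simp]: "ev (sum f I) x = (\<Sum>i\<in>I. ev (f i) x)"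
  by (induction I rule: infinite_finite_induct) auto

lemma ev_prod [simp]: "ev (prod f I) x = (\<Prod>i\<in>I. ev (f i) x)"
  by (induction I rule: infinite_finite_induct) auto

lemma ev_power [simp]: "ev (f ^ n) x = ev f x ^ n"
  by (induction n) auto

lemma ev_of_real [simp]: "ev (of_real c) x = c"
  by (simp add: of_real_def)

lemma ev_numeral [simp]: "ev (numeral n) x = numeral n"
  using ev_of_real[of "numeral n"] by simp

lemma ev_of_nat [simp]: "ev (of_nat n) x = of_nat n"
  using ev_of_real[of "of_nat n"] by simp

lemma polyfun_nonzeroE:
  assumes "f \<noteq> 0"
  obtains x where "ev f x \<noteq> 0"
  using assms polyfun_eqI[of f 0] by auto

text \<open>
  A bounded linear functional on a Euclidean space is an inner product with a fixed vector, so
  the functionals \<^term>\<open>lin v\<close> suffice as generators.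
\<close>

lemma polyfun_induct [case_names linear const add mult]:
  fixes f :: "'a::euclidean_space polyfun"
  assumes "\<And>v. P (lin v)" and "\<And>c. P (of_real c)"
    and "\<And>f g. P f \<Longrightarrow> P g \<Longrightarrow> P (f + g)" and "\<And>f g. P f \<Longrightarrow> P g \<Longrightarrow> P (f * g)"
  shows "P f"
proof -
  have "\<exists>f'. ev f' = f \<and> P f'" if "real_polynomial_function f" for f :: "'a \<Rightarrow> real"
    using that
  proof induction
    case (linear f)
    have "f x = (\<Sum>b\<in>Basis. f b *\<^sub>R b) \<bullet> x" for x
    proof -
      have "f x = f (\<Sum>b\<in>Basis. (x \<bullet> b) *\<^sub>R b)"
        by (simp add: euclidean_representation)
      also have "\<dots> = (\<Sum>b\<in>Basis. (x \<bullet> b) * f b)"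
        using linear by (simp add: bounded_linear.linear linear_sum linear_cmul)
      also have "\<dots> = (\<Sum>b\<in>Basis. f b *\<^sub>R b) \<bullet> x"
        unfolding inner_sum_left inner_scaleR_left
        by (intro sum.cong refl) (metis inner_commute mult.commute)
      finally show ?thesis .
    qed
    then have "ev (lin (\<Sum>b\<in>Basis. f b *\<^sub>R b)) = f"
      unfolding linear_coordinate.rep_eq by (intro ext) (rule sym)
    then show ?case
      using assms(1) by blast
  next
    case (const c)
    then show ?case
      using assms(2)[of c] by (intro exI[of _ "of_real c"]) auto
  next
    case (add f g)
    then obtain f' g' where "ev f' = f" "P f'" "ev g' = g" "P g'" by blast
    then show ?case
      using assms(3)[of f' g'] by (intro exI[of _ "f' + g'"]) auto
  next
    case (mult f g)
    then obtain f' g' where "ev f' = f" "P f'" "ev g' = g" "P g'" by blast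
    then show ?case
      using assms(4)[of f' g'] by (intro exI[of _ "f' * g'"]) auto
  qed
  from this[OF real_polynomial_function_polyfun_apply[of f]] show ?thesis
    by (metis polyfun_apply_inject)
qed

lemma has_derivative_ev: "(ev f has_derivative (\<lambda>v. ev (D v f) x)) (at x)"
proof -
  have "ev f differentiable (at x)"
    using real_polynomial_function_directional_derivative real_polynomial_function_polyfun_apply
    by blast
  then show ?thesis
    by (simp add: frechet_derivative_works directional_derivative.rep_eq)
qed

lemma ev_D_unique:
  assumes "(ev f has_derivative F) (at x)"
  shows "ev (D v f) x = F v"
  using has_derivative_unique[OF assms has_derivative_ev] by simp

lemma D_add [simp]: "D v (f + g) = D v f + D v g"
proof (rule polyfun_eqI)
  fix x
  have "(ev (f + g) has_derivative (\<lambda>v. ev (D v f) x + ev (D v g) x)) (at x)"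
    using has_derivative_add[OF has_derivative_ev has_derivative_ev] by (simp add: plus_polyfun.rep_eq)
  then show "ev (D v (f + g)) x = ev (D v f + D v g) x"
    by (simp add: ev_D_unique)
qed

lemma D_mult: "D v (f * g) = D v f * g + f * D v g"
proof (rule polyfun_eqI)
  fix x
  have "(ev (f * g) has_derivative (\<lambda>v. ev f x * ev (D v g) x + ev (D v f) x * ev g x)) (at x)"
    using has_derivative_mult[OF has_derivative_ev has_derivative_ev] by (simp add: times_polyfun.rep_eq)
  then show "ev (D v (f * g)) x = ev (D v f * g + f * D v g) x"
    by (simp add: ev_D_unique)
qed

lemma D_of_real [simp]: "D v (of_real c) = 0"
proof (rule polyfun_eqI)
  fix x :: 'a
  have "ev (of_real c :: 'a polyfun) = (\<lambda>_. c)" by auto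
  then have "(ev (of_real c) has_derivative (\<lambda>_. 0)) (at x)" by simp
  then show "ev (D v (of_real c)) x = ev 0 x" by (simp add: ev_D_unique)
qed

lemma D_const [simp]: "D v 0 = 0" "D v 1 = 0" "D v (numeral n) = 0" "D v (of_nat m) = 0"
  using D_of_real[of v 0] D_of_real[of v 1] D_of_real[of v "numeral n"] D_of_real[of v "of_nat m"]
  by simp_all

lemma scaleR_polyfun_eq: "c *\<^sub>R (f :: 'a::real_normed_vector polyfun) = of_real c * f"
  by (simp add: scaleR_conv_of_real)

lemma D_scaleR [simp]: "D v (c *\<^sub>R f) = c *\<^sub>R D v f"
  by (simp add: scaleR_polyfun_eq D_mult)

lemma D_minus [simp]: "D v (- f) = - D v f"
  using D_scaleR[of v "-1" f] by simp

lemma D_diff [simp]: "D v (f - g) = D v f - D v g"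
  using D_add[of v f "-g"] by simp

lemma D_sum [simp]: "D v (sum f I) = (\<Sum>i\<in>I. D v (f i))"
  by (induction I rule: infinite_finite_induct) auto

lemma D_lin [simp]: "D v (lin u) = of_real (u \<bullet> v)"
proof (rule polyfun_eqI)
  fix x :: 'a
  have "ev (lin u) = (\<lambda>x. u \<bullet> x)" by auto
  then have "(ev (lin u) has_derivative (\<lambda>v. u \<bullet> v)) (at x)"
    by (simp add: bounded_linear_imp_has_derivative bounded_linear_inner_right)
  then show "ev (D v (lin u)) x = ev (of_real (u \<bullet> v)) x" by (simp add: ev_D_unique)
qed

lemma D_power: "D v (f ^ n) = of_nat n * f ^ (n - 1) * D v f"
proof (induction n)
  case (Suc n)
  then show ?case by (cases n) (simp_all add: D_mult algebra_simps)
qed auto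

lemma D_dir_add: "D (u + v) f = D u f + D v f"
  using linear_add[OF has_derivative_linear[OF has_derivative_ev]]
  by (intro polyfun_eqI) auto

lemma D_dir_scaleR: "D (c *\<^sub>R v) f = c *\<^sub>R D v f"
  using linear_cmul[OF has_derivative_linear[OF has_derivative_ev]]
  by (intro polyfun_eqI) auto

lemma D_dir_zero [simp]: "D 0 f = 0"
  using D_dir_scaleR[of 0 0 f] by simp

lemma D_dir_sum: "D (sum v I) f = (\<Sum>i\<in>I. D (v i) f)"
  by (induction I rule: infinite_finite_induct) (auto simp: D_dir_add)

text \<open>
  Trivial on the generators, and inherited by sums and products through the Leibniz rule.
\<close>

lemma D_commute: "D u (D v f) = D v (D u (f :: 'a::euclidean_space polyfun))"
  by (induction f rule: polyfun_induct) (auto simp: D_mult algebra_simps)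

lemma D_dir_expand: "D v (f :: 'a::euclidean_space polyfun) = (\<Sum>b\<in>Basis. (v \<bullet> b) *\<^sub>R D b f)"
proof -
  have "D v f = D (\<Sum>b\<in>Basis. (v \<bullet> b) *\<^sub>R b) f"
    by (simp add: euclidean_representation)
  then show ?thesis
    by (simp only: D_dir_sum D_dir_scaleR)
qed

definition grad :: "'a::euclidean_space polyfun \<Rightarrow> 'a \<Rightarrow> 'a" where
  "grad f x = (\<Sum>b\<in>Basis. ev (D b f) x *\<^sub>R b)"

lemma inner_grad: "v \<bullet> grad f x = ev (D v f) x"
  by (subst D_dir_expand) (simp add: grad_def inner_sum_right mult.commute)

lemma inner_grad': "grad f x \<bullet> v = ev (D v f) x"
  by (simp add: inner_grad inner_commute)

lemma grad_eqI: "(\<And>v. ev (D v f) x = v \<bullet> w) \<Longrightarrow> grad f x = w"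
  by (metis inner_grad' inner_commute vector_eq_ldot)

lemma grad_add: "grad (f + g) x = grad f x + grad g x"
  by (rule grad_eqI) (simp add: inner_right_distrib inner_grad)

lemma grad_scaleR: "grad (c *\<^sub>R f) x = c *\<^sub>R grad f x"
  by (rule grad_eqI) (simp add: inner_grad)

lemma grad_zero: "grad 0 x = 0"
  by (rule grad_eqI) simp

lemma grad_diff: "grad (f - g) x = grad f x - grad g x"
  by (rule grad_eqI) (simp add: inner_diff_right inner_grad)

definition gradient_product :: "'a::euclidean_space polyfun \<Rightarrow> 'a polyfun \<Rightarrow> 'a polyfun" where
  "gradient_product f g = (\<Sum>b\<in>Basis. D b f * D b g)"

lemma ev_gradient_product: "ev (gradient_product f g) x = grad f x \<bullet> grad g x"
  by (subst euclidean_inner) (simp add: gradient_product_def inner_grad')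

lemma gradient_product_add:
  "gradient_product (f + g) h = gradient_product f h + gradient_product g h"
  "gradient_product h (f + g) = gradient_product h f + gradient_product h g"
  by (auto simp: gradient_product_def algebra_simps sum.distrib)

lemma laplacian_mult:
  "laplacian (f * g) = f * laplacian g + laplacian f * g + 2 * gradient_product f g"
proof -
  have "D b (D b (f * g)) = f * D b (D b g) + D b (D b f) * g + 2 * (D b f * D b g)" for b
    by (simp add: D_mult algebra_simps)
  then show ?thesis
    by (simp add: laplacian_def gradient_product_def sum.distrib sum_distrib_left sum_distrib_right)
qed

subsection \<open>Composition with linear maps\<close>

text \<open>
  Used for linear \<open>L\<close> only, where the composition is polynomial again.
\<close>

definition pullback :: "('a \<Rightarrow> 'a) \<Rightarrow> 'a::euclidean_space polyfun \<Rightarrow> 'a polyfun" where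
  "pullback L f = Abs_polyfun (\<lambda>x. ev f (L x))"

lemma ev_pullback [simp]:
  assumes "linear L"
  shows "ev (pullback L f) x = ev f (L x)"
proof -
  have "polynomial_function L"
    using assms by (simp add: linear_conv_bounded_linear polynomial_function_bounded_linear)
  from real_polynomial_function_compose[OF this real_polynomial_function_polyfun_apply[of f]]
  have "real_polynomial_function (\<lambda>x. ev f (L x))"
    by (simp add: o_def)
  then show ?thesis
    by (simp add: pullback_def Abs_polyfun_inverse)
qed

lemma D_pullback:
  assumes "linear L"
  shows "D v (pullback L f) = pullback L (D (L v) f)"
proof (rule polyfun_eqI)
  fix x
  have comp: "ev (pullback L f) = ev f \<circ> L"
    using assms by auto
  have "(L has_derivative L) (at x)"
    using assms by (simp add: linear_conv_bounded_linear bounded_linear_imp_has_derivative)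
  from diff_chain_at[OF this has_derivative_ev[of f "L x"]]
  have "(ev (pullback L f) has_derivative (\<lambda>v. ev (D (L v) f) (L x))) (at x)"
    unfolding comp by (simp only: o_def)
  then show "ev (D v (pullback L f)) x = ev (pullback L (D (L v) f)) x"
    using assms by (simp add: ev_D_unique)
qed

lemma pullback_mult: "linear L \<Longrightarrow> pullback L (f * g) = pullback L f * pullback L g"
  and pullback_sum: "linear L \<Longrightarrow> pullback L (sum F I) = (\<Sum>i\<in>I. pullback L (F i))"
  by (auto intro!: polyfun_eqI)

text \<open>
  The trace of a bilinear form does not depend on the orthonormal basis. The target space is
  arbitrary so that the form may take values in polynomial functions: this covers both the Laplacian
  and the product of gradients.
\<close>

lemma sum_orthonormal_change:
  fixes q :: "'a::euclidean_space \<Rightarrow> 'a \<Rightarrow> 'b::real_vector" and g :: "'a \<Rightarrow> 'a"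
  assumes q: "bilinear q" and g: "orthogonal_transformation g"
  shows "(\<Sum>b\<in>Basis. q (g b) (g b)) = (\<Sum>b\<in>Basis. q b b)"
proof -
  have lin: "linear g" and iso: "\<And>v w. g v \<bullet> g w = v \<bullet> w"
    using g by (auto simp: orthogonal_transformation_def)
  have qsum: "q (\<Sum>c\<in>Basis. f c *\<^sub>R c) (\<Sum>d\<in>Basis. h d *\<^sub>R d)
      = (\<Sum>c\<in>Basis. \<Sum>d\<in>Basis. (f c * h d) *\<^sub>R q c d)" for f h :: "'a \<Rightarrow> real"
    using q by (simp add: bilinear_sum sum.cartesian_product bilinear_lmul bilinear_rmul
        case_prod_unfold mult.commute)
  have "q (g b) (g b) = (\<Sum>c\<in>Basis. \<Sum>d\<in>Basis. ((g b \<bullet> c) * (g b \<bullet> d)) *\<^sub>R q c d)" for b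
    using qsum[of "\<lambda>c. g b \<bullet> c" "\<lambda>d. g b \<bullet> d"] by (simp add: euclidean_representation)
  then have "(\<Sum>b\<in>Basis. q (g b) (g b))
      = (\<Sum>b\<in>Basis. \<Sum>c\<in>Basis. \<Sum>d\<in>Basis. ((g b \<bullet> c) * (g b \<bullet> d)) *\<^sub>R q c d)"
    by simp
  also have "\<dots> = (\<Sum>c\<in>Basis. \<Sum>d\<in>Basis. (\<Sum>b\<in>Basis. (g b \<bullet> c) * (g b \<bullet> d)) *\<^sub>R q c d)"
    unfolding scaleR_sum_left by (rule trans[OF sum.swap sum.cong[OF refl sum.swap]])
  also have "\<dots> = (\<Sum>c\<in>Basis. \<Sum>d\<in>Basis. (c \<bullet> d) *\<^sub>R q c d)"
  proof -
    have "(\<Sum>b\<in>Basis. (g b \<bullet> c) * (g b \<bullet> d)) = c \<bullet> d" for c d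
    proof -
      obtain c' d' where cd: "c = g c'" "d = g d'"
        using orthogonal_transformation_surj[OF g] by (meson surjE)
      have "(\<Sum>b\<in>Basis. (g b \<bullet> c) * (g b \<bullet> d)) = (\<Sum>b\<in>Basis. (c' \<bullet> b) * (d' \<bullet> b))"
        unfolding cd iso by (simp only: inner_commute)
      also have "\<dots> = c \<bullet> d"
        unfolding cd iso by (rule euclidean_inner[symmetric])
      finally show ?thesis .
    qed
    then show ?thesis by simp
  qed
  also have "\<dots> = (\<Sum>c\<in>Basis. \<Sum>d\<in>Basis. if d = c then q c d else 0)"
    by (intro sum.cong refl) (auto simp: inner_Basis)
  also have "\<dots> = (\<Sum>b\<in>Basis. q b b)"
    by simp
  finally show ?thesis .
qed

lemma laplacian_pullback:
  assumes "orthogonal_transformation g"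
  shows "laplacian (pullback g f) = pullback g (laplacian f)"
proof -
  have lin: "linear g" using assms by (simp add: orthogonal_transformation_def)
  have "bilinear (\<lambda>u v. D u (D v f))"
    by (auto intro!: linearI simp: bilinear_def D_dir_add D_dir_scaleR)
  from sum_orthonormal_change[OF this assms]
  show ?thesis
    by (simp add: laplacian_def D_pullback[OF lin] flip: pullback_sum[OF lin])
qed

lemma gradient_product_pullback:
  assumes "orthogonal_transformation g"
  shows "gradient_product (pullback g f) (pullback g h) = pullback g (gradient_product f h)"
proof -
  have lin: "linear g" using assms by (simp add: orthogonal_transformation_def)
  have "bilinear (\<lambda>u v. D u f * D v h)"
    by (auto intro!: linearI simp: bilinear_def D_dir_add D_dir_scaleR algebra_simps)
  from sum_orthonormal_change[OF this assms]
  show ?thesis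
    by (simp add: gradient_product_def D_pullback[OF lin]
        flip: pullback_sum[OF lin] pullback_mult[OF lin])
qed

subsection \<open>Order of vanishing at a point\<close>

text \<open>
  The polynomials of order at least \<open>m\<close> at \<open>p\<close>, that is the \<open>m\<close>-th power of the maximal ideal of \<open>p\<close>.
  The recursion through first derivatives is what makes the inductions below short.
\<close>

primrec vanishing :: "'a::real_normed_vector \<Rightarrow> nat \<Rightarrow> 'a polyfun set" where
  "vanishing p 0 = UNIV"
| "vanishing p (Suc m) = {f. ev f p = 0 \<and> (\<forall>v. D v f \<in> vanishing p m)}"

lemma vanishing_add: "f \<in> vanishing p m \<Longrightarrow> g \<in> vanishing p m \<Longrightarrow> f + g \<in> vanishing p m"
  by (induction m arbitrary: f g) auto

lemma vanishing_scaleR: "f \<in> vanishing p m \<Longrightarrow> c *\<^sub>R f \<in> vanishing p m"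
  by (induction m arbitrary: f) auto

lemma vanishing_zero: "0 \<in> vanishing p m"
  by (induction m) auto

lemma subspace_vanishing: "subspace (vanishing p m)"
  by (simp add: subspace_def vanishing_add vanishing_scaleR vanishing_zero)

lemma vanishing_diff: "f \<in> vanishing p m \<Longrightarrow> g \<in> vanishing p m \<Longrightarrow> f - g \<in> vanishing p m"
  by (simp add: subspace_diff subspace_vanishing)

lemma vanishing_sum: "(\<And>i. i \<in> I \<Longrightarrow> f i \<in> vanishing p m) \<Longrightarrow> sum f I \<in> vanishing p m"
  by (simp add: subspace_sum subspace_vanishing)

lemma vanishing_Suc_subset: "vanishing p (Suc m) \<subseteq> vanishing p m"
  by (induction m) auto

lemma vanishing_antimono: "m \<le> n \<Longrightarrow> vanishing p n \<subseteq> vanishing p m"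
  by (rule lift_Suc_antimono_le[of "vanishing p"]) (use vanishing_Suc_subset in auto)

lemma vanishing_mult: "f \<in> vanishing p m \<Longrightarrow> g * f \<in> vanishing p m"
proof (induction m arbitrary: f g)
  case (Suc m)
  then have "f \<in> vanishing p m"
    using vanishing_Suc_subset by blast
  with Suc show ?case
    by (auto simp: D_mult intro!: vanishing_add)
qed auto

lemma vanishing_mult_one:
  "f \<in> vanishing p m \<Longrightarrow> ev g p = 0 \<Longrightarrow> g * f \<in> vanishing p (Suc m)"
proof (induction m arbitrary: f g)
  case (Suc m)
  then have "f \<in> vanishing p (Suc m)" "\<And>v. D v f \<in> vanishing p m"
    by auto
  then have "g * D v f \<in> vanishing p (Suc m)" "D v g * f \<in> vanishing p (Suc m)" for v
    using Suc.IH Suc.prems(2) vanishing_mult by blast+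
  then have "D v (g * f) \<in> vanishing p (Suc m)" for v
    unfolding D_mult by (metis vanishing_add)
  with Suc.prems show ?case
    by auto
qed auto

text \<open>
  Along each line through \<open>p\<close> the polynomial restricts to a polynomial in one variable, whose
  coefficients are, up to factorials, the iterated derivatives at \<open>p\<close>.
\<close>

lemma vanishing_all_imp_zero:
  assumes "\<And>m. f \<in> vanishing p m"
  shows "f = (0 :: 'a::real_normed_vector polyfun)"
proof -
  have line: "\<exists>q. \<forall>t. ev f (p + t *\<^sub>R v) = poly q t" for f :: "'a polyfun" and v
    using real_polynomial_function_on_line real_polynomial_function_polyfun_apply by blast
  have "coeff q k = 0"
    if "f \<in> vanishing p (Suc k)" "\<And>t. ev f (p + t *\<^sub>R v) = poly q t" for f q v k
    using that
  proof (induction k arbitrary: f q)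
    case 0
    then show ?case
      using 0(2)[of 0] by (simp add: poly_0_coeff_0)
  next
    case (Suc k)
    have "ev (D v f) (p + t *\<^sub>R v) = poly (pderiv q) t" for t
    proof -
      have "((\<lambda>t. p + t *\<^sub>R v) has_derivative (\<lambda>s. s *\<^sub>R v)) (at t)"
        by (auto intro!: derivative_eq_intros)
      from diff_chain_at[OF this has_derivative_ev[of f "p + t *\<^sub>R v"]]
      have "((\<lambda>t. poly q t) has_derivative (\<lambda>s. ev (D (s *\<^sub>R v) f) (p + t *\<^sub>R v))) (at t)"
        by (simp add: o_def Suc.prems(2))
      moreover have "((\<lambda>t. poly q t) has_derivative (\<lambda>s. poly (pderiv q) t * s)) (at t)"
        using poly_DERIV[of q t] by (simp add: has_field_derivative_def)
      ultimately have "(\<lambda>s. ev (D (s *\<^sub>R v) f) (p + t *\<^sub>R v)) = (\<lambda>s. poly (pderiv q) t * s)"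
        by (rule has_derivative_unique)
      then show ?thesis
        by (metis mult.right_neutral scaleR_one)
    qed
    moreover have "D v f \<in> vanishing p (Suc k)"
      using Suc.prems(1) by (subst (asm) vanishing.simps(2)) blast
    ultimately have "coeff (pderiv q) k = 0"
      using Suc.IH by blast
    then show ?case
      by (simp add: coeff_pderiv)
  qed
  then have q0: "q = 0" if "\<And>t. ev f (p + t *\<^sub>R v) = poly q t" for q v
    using assms that by (metis coeff_0 poly_eq_iff)
  show ?thesis
  proof (rule polyfun_eqI)
    fix x
    obtain q where "\<forall>t. ev f (p + t *\<^sub>R (x - p)) = poly q t"
      using line by blast
    with q0[of "x - p" q] have "ev f (p + 1 *\<^sub>R (x - p)) = 0"
      by (metis poly_0)
    then show "ev f x = ev 0 x" by simp
  qed
qed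


section \<open>Homogeneous polynomials\<close>

lemma homogeneous_add: "homogeneous d f \<Longrightarrow> homogeneous d g \<Longrightarrow> homogeneous d (f + g)"
  and homogeneous_scaleR: "homogeneous d f \<Longrightarrow> homogeneous d (c *\<^sub>R f)"
  and homogeneous_zero: "homogeneous d 0"
  and homogeneous_mult: "homogeneous d f \<Longrightarrow> homogeneous e g \<Longrightarrow> homogeneous (d + e) (f * g)"
  by (auto simp: homogeneous_def algebra_simps power_add)

lemma homogeneous_lin: "homogeneous 1 (lin v)"
  and homogeneous_of_real: "homogeneous 0 (of_real c)"
  by (auto simp: homogeneous_def)

lemma homogeneous_sum: "(\<And>i. i \<in> I \<Longrightarrow> homogeneous d (f i)) \<Longrightarrow> homogeneous d (sum f I)"
  by (induction I rule: infinite_finite_induct) (auto intro: homogeneous_add homogeneous_zero)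

lemma subspace_homogeneous: "subspace {f. homogeneous d f}"
  by (simp add: subspace_def homogeneous_add homogeneous_scaleR homogeneous_zero)

lemma homogeneous_decomposition:
  fixes f :: "'a::euclidean_space polyfun"
  shows "\<exists>c N. (\<forall>k. homogeneous k (c k)) \<and> f = (\<Sum>k\<le>N. c k)"
proof -
  define P where "P f \<longleftrightarrow> (\<exists>N c. (\<forall>k. homogeneous k (c k)) \<and> (\<forall>k>N. c k = 0) \<and> f = (\<Sum>k\<le>N. c k))"
    for f :: "'a polyfun"
  have P_add: "P (f + g)" if "P f" "P g" for f g
  proof -
    obtain N c where c: "\<forall>k. homogeneous k (c k)" "\<forall>k>N. c k = 0" "f = (\<Sum>k\<le>N. c k)"
      using \<open>P f\<close> unfolding P_def by blast
    obtain M e where e: "\<forall>k. homogeneous k (e k)" "\<forall>k>M. e k = 0" "g = (\<Sum>k\<le>M. e k)"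
      using \<open>P g\<close> unfolding P_def by blast
    have "f = (\<Sum>k\<le>max N M. c k)" "g = (\<Sum>k\<le>max N M. e k)"
      unfolding c(3) e(3) using c(2) e(2) by (auto intro!: sum.mono_neutral_left simp: not_le[symmetric])
    then have "f + g = (\<Sum>k\<le>max N M. c k + e k)"
      by (simp add: sum.distrib)
    then show ?thesis
      unfolding P_def using c e
      by (intro exI[of _ "max N M"] exI[of _ "\<lambda>k. c k + e k"]) (auto intro: homogeneous_add)
  qed
  have P_hom: "P f" if "homogeneous d f" for f d
    unfolding P_def using that
    by (intro exI[of _ d] exI[of _ "\<lambda>k. if k = d then f else 0"]) (auto simp: homogeneous_zero)
  have P_sum: "P (sum F I)" if "\<And>i. i \<in> I \<Longrightarrow> P (F i)" for F :: "nat \<Rightarrow> 'a polyfun" and I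
    using that
    by (induction I rule: infinite_finite_induct) (auto intro: P_add P_hom homogeneous_zero)
  have "P f"
  proof (induction f rule: polyfun_induct)
    case (mult f g)
    then obtain N c M e where *: "\<forall>k. homogeneous k (c k)" "f = (\<Sum>k\<le>N. c k)"
        "\<forall>k. homogeneous k (e k)" "g = (\<Sum>k\<le>M. e k)"
      unfolding P_def by blast
    then have "f * g = (\<Sum>i\<le>N. \<Sum>j\<le>M. c i * e j)"
      by (simp add: sum_product)
    moreover have "P (c i * e j)" for i j
      using * homogeneous_mult P_hom by blast
    ultimately show ?case
      by (simp add: P_sum)
  qed (auto intro: P_hom P_add homogeneous_lin homogeneous_of_real)
  then show ?thesis
    unfolding P_def by blast
qed

text \<open>
  Along the line through \<open>x\<close> both sides are polynomials in the scaling factor, so agreement off zero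
  extends to zero. Derivatives of homogeneous polynomials are seen to be homogeneous by cancelling a
  nonzero scaling factor, and this extends the conclusion to all factors.
\<close>

lemma homogeneous_off_zero:
  assumes "\<And>c x. c \<noteq> 0 \<Longrightarrow> ev f (c *\<^sub>R x) = c ^ d * ev f x"
  shows "homogeneous d f"
  unfolding homogeneous_def
proof (intro allI)
  fix c x
  obtain p where p: "\<forall>t. ev f (0 + t *\<^sub>R x) = poly p t"
    using real_polynomial_function_on_line real_polynomial_function_polyfun_apply by blast
  let ?q = "p - monom (ev f x) d"
  have "poly ?q t = 0" if "t \<noteq> 0" for t
    using assms[OF that, of x] p by (simp add: poly_monom)
  then have "- {0} \<subseteq> {t. poly ?q t = 0}"
    by auto
  moreover have "infinite (- {0::real})"
    by (simp add: infinite_UNIV_char_0)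
  ultimately have "?q = 0"
    using poly_roots_finite[of ?q] finite_subset by blast
  then have "poly p c = c ^ d * ev f x"
    by (simp add: poly_monom)
  then show "ev f (c *\<^sub>R x) = c ^ d * ev f x"
    using p by simp
qed

lemma homogeneous_D:
  fixes f :: "'a::euclidean_space polyfun"
  assumes "homogeneous (Suc d) f"
  shows "homogeneous d (D v f)"
proof (rule homogeneous_off_zero)
  fix c :: real and x :: 'a
  assume c: "c \<noteq> 0"
  have lin: "linear (\<lambda>x::'a. c *\<^sub>R x)"
    by (simp add: linear_scaleR)
  have "pullback (\<lambda>x. c *\<^sub>R x) f = c ^ Suc d *\<^sub>R f"
    using assms by (intro polyfun_eqI) (simp add: lin homogeneous_def)
  then have "ev (D v (pullback (\<lambda>x. c *\<^sub>R x) f)) x = c ^ Suc d * ev (D v f) x"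
    by simp
  then show "ev (D v f) (c *\<^sub>R x) = c ^ d * ev (D v f) x"
    using c by (simp add: D_pullback[OF lin] lin D_dir_scaleR)
qed

lemma homogeneous_0_const: "homogeneous 0 f \<Longrightarrow> f = of_real (ev f 0)"
  unfolding homogeneous_def
  by (intro polyfun_eqI) (metis ev_of_real mult_1 power_0 scaleR_zero_left)

lemma D_homogeneous_0: "homogeneous 0 f \<Longrightarrow> D v f = 0"
  by (metis homogeneous_0_const D_of_real)

definition euler :: "'a::euclidean_space polyfun \<Rightarrow> 'a polyfun" where
  "euler f = (\<Sum>b\<in>Basis. lin b * D b f)"

lemma ev_euler: "ev (euler f) x = ev (D x f) x"
  by (subst D_dir_expand) (simp add: euler_def inner_commute)

lemma euler_homogeneous:
  assumes "homogeneous d f"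
  shows "euler f = of_nat d * f"
proof (rule polyfun_eqI)
  fix x :: 'a
  have "((\<lambda>t. t *\<^sub>R x) has_derivative (\<lambda>s. s *\<^sub>R x)) (at 1)"
    by (auto intro!: derivative_eq_intros)
  from diff_chain_at[OF this has_derivative_ev[of f "1 *\<^sub>R x"]]
  have "((\<lambda>t. ev f (t *\<^sub>R x)) has_derivative (\<lambda>s. ev (D (s *\<^sub>R x) f) x)) (at 1)"
    by (simp add: o_def)
  moreover have "(\<lambda>t. ev f (t *\<^sub>R x)) = (\<lambda>t. t ^ d * ev f x)"
    using assms by (auto simp: homogeneous_def)
  moreover have "((\<lambda>t::real. t ^ d * ev f x) has_derivative (\<lambda>s. s * (of_nat d * ev f x))) (at 1)"
    by (auto intro!: derivative_eq_intros simp: algebra_simps)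
  ultimately have "(\<lambda>s. ev (D (s *\<^sub>R x) f) x) = (\<lambda>s. s * (of_nat d * ev f x))"
    using has_derivative_unique by metis
  then have "ev (D (1 *\<^sub>R x) f) x = 1 * (of_nat d * ev f x)"
    by (rule fun_cong)
  then show "ev (euler f) x = ev (of_nat d * f) x"
    by (simp add: ev_euler)
qed

text \<open>
  By Euler's identity \<open>(d + 1) f = \<Sum> x\<^sub>b \<partial>\<^sub>b f\<close>, a spanning set in degree \<open>d + 1\<close> arises by multiplying one
  of degree \<open>d\<close> with the coordinates.
\<close>

lemma finite_dimensional_homogeneous:
  obtains T where "finite T" "{f :: 'a::euclidean_space polyfun. homogeneous d f} \<subseteq> span T"
proof -
  have "\<exists>T. finite T \<and> {f :: 'a polyfun. homogeneous d f} \<subseteq> span T"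
  proof (induction d)
    case 0
    have "f \<in> span {1}" if "homogeneous 0 f" for f :: "'a polyfun"
      using homogeneous_0_const[OF that] by (metis of_real_def span_base span_scale singletonI)
    then show ?case by (intro exI[of _ "{1}"]) auto
  next
    case (Suc d)
    then obtain T where T: "finite T" "\<And>f :: 'a polyfun. homogeneous d f \<Longrightarrow> f \<in> span T"
      by blast
    define T' where "T' = (\<lambda>(b, t). lin b * t) ` (Basis \<times> T)"
    have mult: "lin b * g \<in> span T'" if "b \<in> Basis" "g \<in> span T" for b g
    proof -
      have "linear (\<lambda>g. lin b * g :: 'a polyfun)"
        by (auto intro!: linearI simp: algebra_simps)
      from linear_span_image[OF this, of T] have "lin b * g \<in> span ((\<lambda>g. lin b * g) ` T)"
        using that by blast
      moreover have "(\<lambda>g. lin b * g) ` T \<subseteq> T'"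
        using that by (auto simp: T'_def)
      ultimately show ?thesis
        using span_mono by blast
    qed
    have "f \<in> span T'" if "homogeneous (Suc d) f" for f :: "'a polyfun"
    proof -
      have "euler f \<in> span T'"
        unfolding euler_def by (intro span_sum mult T homogeneous_D that)
      moreover have "f = (1 / real (Suc d)) *\<^sub>R euler f"
      proof -
        have "euler f = real (Suc d) *\<^sub>R f"
          unfolding euler_homogeneous[OF that] by (simp add: scaleR_polyfun_eq)
        then show ?thesis by simp
      qed
      ultimately show ?thesis
        by (metis span_scale)
    qed
    then show ?case
      using T(1) by (intro exI[of _ T']) (auto simp: T'_def)
  qed
  then show ?thesis using that by blast
qed

section \<open>Closure properties of Laplacian algebras\<close>

lemma subalgebraD:
  assumes "subalgebra A"
  shows "subspace A" "1 \<in> A" "\<And>f g. f \<in> A \<Longrightarrow> g \<in> A \<Longrightarrow> f * g \<in> A"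
    "0 \<in> A" "\<And>f g. f \<in> A \<Longrightarrow> g \<in> A \<Longrightarrow> f + g \<in> A" "\<And>f g. f \<in> A \<Longrightarrow> g \<in> A \<Longrightarrow> f - g \<in> A"
    "\<And>c f. f \<in> A \<Longrightarrow> c *\<^sub>R f \<in> A"
  using assms
  by (auto simp: subalgebra_def subspace_0 subspace_add subspace_diff subspace_scale)

lemma subalgebra_sum: "subalgebra A \<Longrightarrow> (\<And>i. i \<in> I \<Longrightarrow> f i \<in> A) \<Longrightarrow> sum f I \<in> A"
  by (simp add: subspace_sum subalgebraD)

lemma subalgebra_power: "subalgebra A \<Longrightarrow> f \<in> A \<Longrightarrow> f ^ n \<in> A"
  by (induction n) (auto simp: subalgebraD)

lemma subalgebra_prod: "subalgebra A \<Longrightarrow> (\<And>i. i \<in> I \<Longrightarrow> f i \<in> A) \<Longrightarrow> prod f I \<in> A"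
  by (induction I rule: infinite_finite_induct) (auto simp: subalgebraD)

lemma laplacian_algebraD:
  assumes "laplacian_algebra A"
  shows "subalgebra A" "radius_squared \<in> A" "\<And>f. f \<in> A \<Longrightarrow> laplacian f \<in> A"
  using assms by (auto simp: laplacian_algebra_def)

lemma half_double_polyfun: "(1 / 2) *\<^sub>R (2 * f) = (f :: 'a::real_normed_vector polyfun)"
  by (rule polyfun_eqI) simp

text \<open>
  The key consequence of stability under the Laplacian: by the product rule for \<open>\<Delta>\<close>, the algebra
  knows the Gram matrices of its gradients.
\<close>

lemma gradient_product_closed:
  assumes "laplacian_algebra A" "f \<in> A" "g \<in> A"
  shows "gradient_product f g \<in> A"
proof -
  have "gradient_product f g = (1 / 2) *\<^sub>R (laplacian (f * g) - f * laplacian g - laplacian f * g)"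
    by (simp add: laplacian_mult half_double_polyfun)
  then show ?thesis
    using assms by (simp add: laplacian_algebraD subalgebraD)
qed

lemma D_radius_squared: "D v radius_squared = 2 * lin v"
proof -
  have "D v radius_squared = (\<Sum>b\<in>Basis. 2 * (of_real (b \<bullet> v) * lin b))"
    by (simp add: radius_squared_def D_power algebra_simps)
  also have "\<dots> = 2 * (\<Sum>b\<in>Basis. of_real (b \<bullet> v) * lin b)"
    by (simp add: sum_distrib_left)
  also have "(\<Sum>b\<in>Basis. of_real (b \<bullet> v) * lin b) = lin v"
  proof (rule polyfun_eqI)
    fix x
    have "ev (\<Sum>b\<in>Basis. of_real (b \<bullet> v) * lin b) x = (\<Sum>b\<in>Basis. (b \<bullet> v) * (b \<bullet> x))"
      by simp
    also have "\<dots> = (\<Sum>b\<in>Basis. (v \<bullet> b) * (x \<bullet> b))"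
      by (simp only: inner_commute)
    also have "\<dots> = v \<bullet> x"
      by (rule euclidean_inner[symmetric])
    finally show "ev (\<Sum>b\<in>Basis. of_real (b \<bullet> v) * lin b) x = ev (lin v) x"
      by simp
  qed
  finally show ?thesis .
qed

lemma ev_radius_squared: "ev radius_squared x = x \<bullet> x"
  by (simp add: radius_squared_def euclidean_inner[of x x] inner_commute power2_eq_square)

lemma euler_closed:
  assumes "laplacian_algebra A" "f \<in> A"
  shows "euler f \<in> A"
proof -
  have "euler f = (1 / 2) *\<^sub>R gradient_product radius_squared f"
    by (rule polyfun_eqI) (simp add: euler_def gradient_product_def D_radius_squared sum_distrib_left mult.assoc)
  then show ?thesis
    using assms by (simp add: gradient_product_closed laplacian_algebraD subalgebraD)
qed

text \<open>
  Homogeneous components are eigenvectors of the Euler operator with distinct eigenvalues, and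
  \<open>A\<close> is stable under this operator. The operator \<open>E - j\<close>, with \<open>E\<close> the Euler operator, removes the component of degree \<open>j\<close> and
  rescales the others by nonzero factors.
\<close>

lemma homogeneous_components_closed:
  assumes A: "laplacian_algebra A" and hom: "\<And>k. homogeneous k (c k)"
    and "finite K" and "(\<Sum>k\<in>K. c k) \<in> A" and "k \<in> K"
  shows "c k \<in> A"
  using \<open>finite K\<close> hom \<open>(\<Sum>k\<in>K. c k) \<in> A\<close> \<open>k \<in> K\<close>
proof (induction K arbitrary: c k rule: finite_induct)
  case (insert j K)
  note alg = subalgebraD[OF laplacian_algebraD(1)[OF A]]
  let ?s = "\<Sum>k\<in>insert j K. c k"
  have "euler ?s - of_nat j * ?s = (\<Sum>k\<in>insert j K. euler (c k) - of_nat j * c k)"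
    by (simp add: euler_def sum_distrib_left sum_subtractf algebra_simps sum.distrib sum.swap[of _ Basis])
  also have "\<dots> = (\<Sum>k\<in>insert j K. (real k - real j) *\<^sub>R c k)"
    by (intro sum.cong refl)
       (simp add: euler_homogeneous insert.prems scaleR_polyfun_eq algebra_simps)
  also have "\<dots> = (\<Sum>k\<in>K. (real k - real j) *\<^sub>R c k)"
    using insert.hyps by simp
  finally have eq: "euler ?s - of_nat j * ?s = (\<Sum>k\<in>K. (real k - real j) *\<^sub>R c k)" .
  have "of_nat j * ?s = real j *\<^sub>R ?s"
    by (simp add: scaleR_polyfun_eq)
  then have "euler ?s - of_nat j * ?s \<in> A"
    using insert.prems(2) by (simp only: alg euler_closed[OF A])
  then have "(real k - real j) *\<^sub>R c k \<in> A" if "k \<in> K" for k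
    unfolding eq using that insert.prems(1)
    by (intro insert.IH[of "\<lambda>k. (real k - real j) *\<^sub>R c k"]) (auto intro: homogeneous_scaleR)
  then have "(1 / (real k - real j)) *\<^sub>R ((real k - real j) *\<^sub>R c k) \<in> A" if "k \<in> K" for k
    using that by (simp only: alg)
  then have K: "c k \<in> A" if "k \<in> K" for k
    using that insert.hyps by (metis of_nat_eq_iff right_minus_eq scaleR_scaleR scaleR_one
        nonzero_eq_divide_eq mult.commute)
  have "c j = ?s - (\<Sum>k\<in>K. c k)"
    using insert.hyps by simp
  then have "c j \<in> A"
    using insert.prems(2) K laplacian_algebraD(1)[OF A] by (metis alg(6) subalgebra_sum)
  with K insert.prems(3) show ?case
    by auto
qed auto

section \<open>Division in Laplacian algebras via the Fischer product\<close>

text \<open>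
  The full contraction \<open>\<langle>D\<^sup>k f, D\<^sup>k g\<rangle>\<close> of the tensors of \<open>k\<close>-th derivatives. For \<open>f\<close> homogeneous of
  degree \<open>k\<close> this is \<open>k!\<close> times the differential operator \<open>f(\<partial>)\<close> applied to \<open>g\<close>; for both of degree \<open>k\<close> it
  is, up to the factor \<open>k!\<close>, the Fischer inner product of \<open>f\<close> and \<open>g\<close>.
\<close>

primrec contraction :: "nat \<Rightarrow> 'a::euclidean_space polyfun \<Rightarrow> 'a polyfun \<Rightarrow> 'a polyfun" where
  "contraction 0 f g = f * g"
| "contraction (Suc k) f g = (\<Sum>b\<in>Basis. contraction k (D b f) (D b g))"

lemma contraction_add:
  "contraction k (f + g) h = contraction k f h + contraction k g h"
  "contraction k h (f + g) = contraction k h f + contraction k h g"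
  by (induction k arbitrary: f g h) (auto simp: algebra_simps sum.distrib)

lemma contraction_scaleR:
  "contraction k (c *\<^sub>R f) h = c *\<^sub>R contraction k f h"
  "contraction k h (c *\<^sub>R f) = c *\<^sub>R contraction k h f"
  by (induction k arbitrary: f h) (auto simp: scaleR_sum_right)

lemma contraction_zero: "contraction k 0 h = 0" "contraction k h 0 = 0"
  using contraction_scaleR(1)[of k 0 0 h] contraction_scaleR(2)[of k h 0 0] by simp_all

lemma contraction_sum: "contraction k h (sum f I) = (\<Sum>i\<in>I. contraction k h (f i))"
  by (induction I rule: infinite_finite_induct) (auto simp: contraction_add contraction_zero)

lemma contraction_sym: "contraction k f g = contraction k g f"
  by (induction k arbitrary: f g) (auto simp: mult.commute)

lemma D_contraction: "D v (contraction k f g) = contraction k (D v f) g + contraction k f (D v g)"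
proof (induction k arbitrary: f g)
  case (Suc k)
  then show ?case
    by (simp add: sum.distrib D_commute[of v])
qed (auto simp: D_mult)

lemma laplacian_contraction:
  "laplacian (contraction k f g) =
    contraction k (laplacian f) g + contraction k f (laplacian g) + 2 * contraction (Suc k) f g"
proof (induction k arbitrary: f g)
  case 0
  then show ?case
    by (simp add: laplacian_mult gradient_product_def)
next
  case (Suc k)
  have lap_sum: "laplacian (sum F Basis) = (\<Sum>b\<in>Basis. laplacian (F b))" for F :: "'a \<Rightarrow> 'a polyfun"
    unfolding laplacian_def D_sum by (rule sum.swap)
  have lap_D: "laplacian (D b f) = D b (laplacian f)" for b and f :: "'a polyfun"
    by (simp add: laplacian_def D_commute[of b])
  have "laplacian (contraction (Suc k) f g) = (\<Sum>b\<in>Basis. laplacian (contraction k (D b f) (D b g)))"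
    by (simp add: lap_sum)
  also have "\<dots> = (\<Sum>b\<in>Basis. contraction k (D b (laplacian f)) (D b g)
      + contraction k (D b f) (D b (laplacian g)) + 2 * contraction (Suc k) (D b f) (D b g))"
    unfolding Suc lap_D ..
  also have "\<dots> = contraction (Suc k) (laplacian f) g + contraction (Suc k) f (laplacian g)
      + 2 * (\<Sum>b\<in>Basis. contraction (Suc k) (D b f) (D b g))"
    by (simp only: sum.distrib sum_distrib_left contraction.simps(2))
  also have "(\<Sum>b\<in>Basis. contraction (Suc k) (D b f) (D b g)) = contraction (Suc (Suc k)) f g"
    by (rule contraction.simps(2)[symmetric])
  finally show ?case .
qed

text \<open>
  Applying \<open>\<Delta>\<close> to a contraction of order \<open>k\<close> yields contractions of order \<open>k\<close> of elements of \<open>A\<close> and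
  twice the contraction of order \<open>k + 1\<close>.
\<close>

lemma contraction_closed:
  assumes "laplacian_algebra A" "f \<in> A" "g \<in> A"
  shows "contraction k f g \<in> A"
  using assms(2,3)
proof (induction k arbitrary: f g)
  case 0
  then show ?case
    using assms(1) by (simp add: laplacian_algebraD subalgebraD)
next
  case (Suc k)
  have "contraction (Suc k) f g = (1 / 2) *\<^sub>R (laplacian (contraction k f g)
      - contraction k (laplacian f) g - contraction k f (laplacian g))"
    by (simp only: laplacian_contraction) (simp add: half_double_polyfun del: contraction.simps)
  moreover have "\<dots> \<in> A"
    using assms(1) Suc by (intro subalgebraD) (auto simp: laplacian_algebraD)
  ultimately show ?case
    by (simp only:)
qed

lemma contraction_lower_degree:
  "homogeneous j f \<Longrightarrow> j < k \<Longrightarrow> contraction k f g = 0"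
proof (induction k arbitrary: j f g)
  case (Suc k)
  show ?case
  proof (cases j)
    case 0
    then show ?thesis
      using Suc.prems by (simp add: D_homogeneous_0 contraction_zero)
  next
    case (Suc i)
    then show ?thesis
      using Suc.prems Suc.IH[of i] homogeneous_D[of i f] by (auto intro!: sum.neutral)
  qed
qed auto

lemma contraction_homogeneous:
  "homogeneous m f \<Longrightarrow> homogeneous (d + m) g \<Longrightarrow> homogeneous d (contraction m f g)"
proof (induction m arbitrary: f g)
  case 0
  then show ?case
    using homogeneous_mult[of 0 f d g] by simp
next
  case (Suc m)
  then show ?case
    by (auto intro!: homogeneous_sum Suc.IH homogeneous_D)
qed

lemma D_contraction_homogeneous:
  assumes "homogeneous m w"
  shows "D v (contraction m w b) = contraction m w (D v b)"
proof (cases m)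
  case 0
  then show ?thesis
    using assms by (simp add: D_mult D_homogeneous_0)
next
  case (Suc k)
  then show ?thesis
    using assms by (simp add: D_contraction contraction_lower_degree[of k "D v w"] homogeneous_D
        del: contraction.simps)
qed

text \<open>
  Multiplication by \<open>w\<close> is adjoint to \<open>w(\<partial>)\<close> for the Fischer product. One differentiation splits the
  left side by the Leibniz rule into a part lowering the degree of \<open>w\<close> and a part lowering the degree of
  \<open>h\<close>, and the two binomial coefficients add up by Pascal's rule.
\<close>

lemma contraction_adjoint:
  assumes "homogeneous m w" "homogeneous d h"
  shows "contraction (d + m) (w * h) b = of_nat ((d + m) choose m) * contraction d h (contraction m w b)"
  using assms
proof (induction "d + m" arbitrary: d m w h b)
  case 0
  then show ?case by (simp add: mult_ac)
next
  case (Suc n)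
  let ?S = "\<lambda>F. \<Sum>c\<in>Basis. F c :: 'a polyfun"
  have split: "contraction (Suc n) (w * h) b =
      ?S (\<lambda>c. contraction n (D c w * h) (D c b)) + ?S (\<lambda>c. contraction n (w * D c h) (D c b))"
    by (simp add: D_mult contraction_add sum.distrib)
  have w_part: "?S (\<lambda>c. contraction n (D c w * h) (D c b)) =
      of_nat (n choose m') * contraction d h (contraction m w b)" if m: "m = Suc m'" for m'
  proof -
    have "contraction n (D c w * h) (D c b) =
        of_nat (n choose m') * contraction d h (contraction m' (D c w) (D c b))" for c
      using Suc.hyps(1)[of d m' "D c w" h "D c b"] Suc.hyps(2) Suc.prems m homogeneous_D by auto
    then show ?thesis
      by (simp add: m contraction_sum sum_distrib_left)
  qed
  have h_part: "?S (\<lambda>c. contraction n (w * D c h) (D c b)) =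
      of_nat (n choose m) * contraction d h (contraction m w b)" if d: "d = Suc d'" for d'
  proof -
    have "contraction n (w * D c h) (D c b) =
        of_nat (n choose m) * contraction d' (D c h) (contraction m w (D c b))" for c
      using Suc.hyps(1)[of d' m w "D c h" "D c b"] Suc.hyps(2) Suc.prems d homogeneous_D by auto
    then show ?thesis
      by (simp add: d sum_distrib_left D_contraction_homogeneous[OF Suc.prems(1)])
  qed
  show ?case
  proof (cases m)
    case 0
    then obtain d' where "d = Suc d'"
      using Suc.hyps(2) by (cases d) auto
    then show ?thesis
      using split h_part 0 Suc.hyps(2) D_homogeneous_0[of w] Suc.prems
      by (simp add: contraction_zero)
  next
    case m: (Suc m')
    show ?thesis
    proof (cases d)
      case 0
      then show ?thesis
        using split w_part[OF m] Suc.hyps(2) m D_homogeneous_0[of h] Suc.prems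
        by (simp add: contraction_zero del: contraction.simps)
    next
      case (Suc d')
      then have "contraction (Suc n) (w * h) b =
          (of_nat (n choose m') + of_nat (n choose m)) * contraction d h (contraction m w b)"
        by (simp only: split w_part[OF m] h_part distrib_right)
      moreover have "of_nat (n choose m') + of_nat (n choose m) = (of_nat (Suc n choose m) :: 'a polyfun)"
        by (simp add: m)
      ultimately show ?thesis
        by (simp only: Suc.hyps(2))
    qed
  qed
qed

lemma ev_contraction_self_nonneg: "0 \<le> ev (contraction k f f) x"
  by (induction k arbitrary: f) (auto intro: sum_nonneg)

text \<open>
  Positive definiteness of the Fischer product in a fixed degree: all first derivatives vanish by
  induction, and Euler's identity recovers \<open>f\<close> from them.
\<close>

lemma contraction_self_eq_0:
  "homogeneous d f \<Longrightarrow> ev (contraction d f f) x = 0 \<Longrightarrow> f = 0"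
proof (induction d arbitrary: f)
  case 0
  then have "ev f x = 0" by simp
  then show ?case
    using homogeneous_0_const[OF 0(1)] by (metis ev_of_real of_real_0)
next
  case (Suc d)
  then have "\<forall>b\<in>Basis. ev (contraction d (D b f) (D b f)) x = 0"
    by (simp add: sum_nonneg_eq_0_iff ev_contraction_self_nonneg)
  then have "D b f = 0" if "b \<in> Basis" for b
    using Suc.IH[of "D b f"] Suc.prems(1) homogeneous_D that by blast
  then have "euler f = 0"
    by (simp add: euler_def)
  then show ?case
    using euler_homogeneous[OF Suc.prems(1)] by (metis mult_eq_0_iff of_nat_eq_0_iff nat.distinct(1)
        ev_of_nat zero_polyfun.rep_eq)
qed

text \<open>
  Gram-Schmidt. The form is assumed anisotropic on the subspace only, because the Fischer product of
  degree \<open>d\<close> is definite on homogeneous polynomials of degree \<open>d\<close> and not on all polynomials.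
\<close>

lemma orthogonal_projection_exists:
  fixes F :: "'b::real_vector \<Rightarrow> 'b \<Rightarrow> real"
  assumes F: "bilinear F" "\<And>x y. F x y = F y x"
    and "finite S" and "\<And>b. b \<in> span S \<Longrightarrow> F b b = 0 \<Longrightarrow> b = 0"
  shows "\<exists>a\<in>span S. \<forall>b\<in>span S. F (x - a) b = 0"
  using \<open>finite S\<close> assms(4)
proof (induction S arbitrary: x rule: finite_induct)
  case empty
  then show ?case
    using bilinear_rzero[OF F(1)] by auto
next
  case (insert s S)
  have sub: "span S \<subseteq> span (insert s S)"
    by (intro span_mono) auto
  then have IH: "\<exists>a\<in>span S. \<forall>b\<in>span S. F (x - a) b = 0" for x
    using insert by blast
  obtain s0 where s0: "s0 \<in> span S" "\<And>b. b \<in> span S \<Longrightarrow> F (s - s0) b = 0"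
    using IH by blast
  obtain a0 where a0: "a0 \<in> span S" "\<And>b. b \<in> span S \<Longrightarrow> F (x - a0) b = 0"
    using IH by blast
  define s' where "s' = s - s0"
  have s'_in: "s' \<in> span (insert s S)"
    unfolding s'_def using s0 sub by (intro span_diff) (auto intro: span_base)
  define c where "c = F x s' / F s' s'"
  note blin = bilinear_ladd[OF F(1)] bilinear_radd[OF F(1)] bilinear_lmul[OF F(1)]
    bilinear_rmul[OF F(1)] bilinear_lsub[OF F(1)] bilinear_rsub[OF F(1)]
  have c: "F (x - (a0 + c *\<^sub>R s')) s' = 0"
  proof (cases "s' = 0")
    case True
    then show ?thesis
      using bilinear_rzero[OF F(1)] by simp
  next
    case False
    then have "F s' s' \<noteq> 0"
      using insert.prems s'_in by blast
    moreover have "F a0 s' = 0"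
      using F(2) s0(2)[OF a0(1)] by (simp add: s'_def)
    ultimately show ?thesis
      by (simp add: blin c_def)
  qed
  have "F (x - (a0 + c *\<^sub>R s')) b = 0" if b: "b \<in> span (insert s S)" for b
  proof -
    obtain k where k: "b - k *\<^sub>R s \<in> span S"
      using b unfolding span_breakdown_eq by blast
    define b' where "b' = b - k *\<^sub>R s + k *\<^sub>R s0"
    have b': "b' \<in> span S"
      unfolding b'_def using k s0(1) by (intro span_add span_scale)
    have b_eq: "b = k *\<^sub>R s' + b'"
      by (simp add: b'_def s'_def algebra_simps)
    have "F (x - (a0 + c *\<^sub>R s')) b = k * F (x - (a0 + c *\<^sub>R s')) s' + F (x - a0) b' - c * F s' b'"
      unfolding b_eq by (simp add: blin algebra_simps)
    then show ?thesis
      using c a0(2)[OF b'] s0(2)[OF b'] by (simp add: s'_def)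
  qed
  moreover have "a0 + c *\<^sub>R s' \<in> span (insert s S)"
    using a0 sub s'_in by (auto intro: span_add span_scale)
  ultimately show ?case by blast
qed

text \<open>
  Project \<open>f\<close> to the part of \<open>A\<close> in degree \<open>d\<close>, with remainder \<open>h\<close>. Then \<open>w h\<close> lies in \<open>A\<close>, and by adjointness
  its Fischer product with itself is, up to a factor, that of \<open>h\<close> with \<open>w(\<partial>)(w h)\<close>. The latter is an
  element of \<open>A\<close> of degree \<open>d\<close> and hence orthogonal to \<open>h\<close>; so \<open>w h = 0\<close>.
\<close>

lemma laplacian_algebra_division:
  fixes A :: "'a::euclidean_space polyfun set"
  assumes A: "laplacian_algebra A" and w: "w \<in> A" "homogeneous m w" "w \<noteq> 0"
    and f: "homogeneous d f" "w * f \<in> A"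
  shows "f \<in> A"
proof -
  note alg = laplacian_algebraD(1)[OF A]
  define W where "W = A \<inter> {f. homogeneous d f}"
  have "subspace W"
    using subalgebraD(1)[OF alg] subspace_homogeneous by (auto simp: W_def intro: subspace_inter)
  obtain S where S: "S \<subseteq> W" "independent S" "W \<subseteq> span S"
    using maximal_independent_subset .
  obtain T :: "'a polyfun set" where T: "finite T" "{f. homogeneous d f} \<subseteq> span T"
    using finite_dimensional_homogeneous .
  have "finite S"
    using S T independent_span_bound[of T S] by (auto simp: W_def)
  have span_S: "span S = W"
    using S \<open>subspace W\<close> by (metis span_minimal subset_antisym)
  let ?F = "\<lambda>f g. ev (contraction d f g) 0"
  have bil: "bilinear ?F"
    by (auto intro!: linearI simp: bilinear_def contraction_add contraction_scaleR)
  have "\<exists>a\<in>span S. \<forall>b\<in>span S. ?F (f - a) b = 0"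
    by (rule orthogonal_projection_exists[OF bil _ \<open>finite S\<close>])
       (auto simp: span_S W_def contraction_sym intro: contraction_self_eq_0)
  then obtain a where a: "a \<in> W" "\<And>b. b \<in> W \<Longrightarrow> ?F (f - a) b = 0"
    unfolding span_S by blast
  define h where "h = f - a"
  have h: "homogeneous d h"
    using f(1) a(1) subspace_diff[OF subspace_homogeneous] by (auto simp: W_def h_def)
  have "w * h = w * f - w * a"
    by (simp add: h_def algebra_simps)
  then have wh: "w * h \<in> A"
    using subalgebraD[OF alg] w(1) f(2) a(1) by (simp add: W_def)
  have hom_wh: "homogeneous (d + m) (w * h)"
    using homogeneous_mult[OF w(2) h] by (simp add: add.commute)
  have "contraction m w (w * h) \<in> W"
    using contraction_closed[OF A w(1) wh] contraction_homogeneous[OF w(2) hom_wh]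
    by (simp add: W_def)
  then have "ev (contraction (d + m) (w * h) (w * h)) 0 = 0"
    using a(2) by (simp add: contraction_adjoint[OF w(2) h] flip: h_def)
  then have "w * h = 0"
    using contraction_self_eq_0[OF hom_wh] by blast
  then have "f = a"
    using w(3) by (simp add: h_def)
  then show ?thesis
    using a(1) by (simp add: W_def)
qed


section \<open>Regular points and the symmetry group\<close>

definition regular_point :: "'a::euclidean_space polyfun set \<Rightarrow> 'a \<Rightarrow> bool" where
  "regular_point A p \<longleftrightarrow> (\<forall>v. \<exists>f\<in>A. grad f p = v)"

definition symmetry_group :: "'a::euclidean_space polyfun set \<Rightarrow> ('a \<Rightarrow> 'a) set" where
  "symmetry_group A = {g. orthogonal_transformation g \<and> (\<forall>f\<in>A. pullback g f = f)}"

lemma orthogonal_transformation_linearI: "orthogonal_transformation g \<Longrightarrow> linear g"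
  by (simp add: orthogonal_transformation_def)

text \<open>
  Gradients of elements of \<open>A\<close> have the same inner products at \<open>p\<close> and at \<open>q\<close>. Hence the gradient at \<open>q\<close>
  depends only on the gradient at \<open>p\<close>: if the difference of two elements has zero gradient at \<open>p\<close>, then
  also at \<open>q\<close>. The resulting assignment is the required isometry.
\<close>

lemma gradient_isometry:
  assumes A: "laplacian_algebra A" and reg: "regular_point A p"
    and same: "\<And>f. f \<in> A \<Longrightarrow> ev f p = ev f q"
  obtains g where "orthogonal_transformation g" "\<And>f. f \<in> A \<Longrightarrow> g (grad f p) = grad f q"
proof -
  note alg = subalgebraD[OF laplacian_algebraD(1)[OF A]]
  have inner: "grad f p \<bullet> grad h p = grad f q \<bullet> grad h q" if "f \<in> A" "h \<in> A" for f h
    using same[OF gradient_product_closed[OF A that]] by (simp add: ev_gradient_product)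
  define s where "s v = (SOME f. f \<in> A \<and> grad f p = v)" for v
  have s: "s v \<in> A" "grad (s v) p = v" for v
    using someI_ex[of "\<lambda>f. f \<in> A \<and> grad f p = v"] reg
    unfolding s_def regular_point_def by blast+
  define g where "g v = grad (s v) q" for v
  have g: "g (grad f p) = grad f q" if "f \<in> A" for f
  proof -
    (* its gradient vanishes at p, hence also at q *)
    let ?d = "s (grad f p) - f"
    have "?d \<in> A" using that s by (simp add: alg)
    then have "grad ?d q \<bullet> grad ?d q = grad ?d p \<bullet> grad ?d p"
      by (simp add: inner)
    also have "\<dots> = 0"
      by (simp add: grad_diff s)
    finally show ?thesis
      by (simp add: g_def grad_diff)
  qed
  have "linear g"
  proof (rule linearI)
    fix u v :: 'a and c :: real
    show "g (u + v) = g u + g v"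
      using g[of "s u + s v"] s by (simp add: alg grad_add g_def)
    show "g (c *\<^sub>R u) = c *\<^sub>R g u"
      using g[of "c *\<^sub>R s u"] s by (simp add: alg grad_scaleR g_def)
  qed
  moreover have "g u \<bullet> g v = u \<bullet> v" for u v
    using inner[of "s u" "s v"] s by (simp add: g_def)
  ultimately have "orthogonal_transformation g"
    by (simp add: orthogonal_transformation_def)
  with g that show ?thesis by blast
qed

text \<open>
  Up to higher order, the gradient of \<open>h\<close> may be frozen at its value in \<open>p\<close>.
\<close>

lemma vanishing_gradient_product:
  assumes "f \<in> vanishing p (Suc m)"
  shows "gradient_product f h - D (grad h p) f \<in> vanishing p (Suc m)"
proof -
  have "gradient_product f h - D (grad h p) f
      = (\<Sum>b\<in>Basis. (D b h - of_real (ev (D b h) p)) * D b f)"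
    by (subst D_dir_expand[of "grad h p"])
       (simp add: gradient_product_def inner_grad' scaleR_polyfun_eq algebra_simps sum_subtractf)
  moreover have "(D b h - of_real (ev (D b h) p)) * D b f \<in> vanishing p (Suc m)" for b
    using assms by (intro vanishing_mult_one) auto
  ultimately show ?thesis
    by (simp only: vanishing_sum)
qed

text \<open>
  Write \<open>\<alpha>\<^sub>f = f \<circ> g - f\<close>. Because \<open>g\<close> is an isometry, \<open>\<alpha>\<close> applied to \<open>\<langle>\<nabla>a, \<nabla>f\<rangle>\<close> is
  \<open>\<langle>\<nabla>\<alpha>\<^sub>a, \<nabla>f\<rangle> + \<langle>\<nabla>a, \<nabla>\<alpha>\<^sub>f\<rangle>\<close> up to terms of higher order. If all defects have order at least \<open>m\<close>, then so
  has \<open>\<partial>\<^sub>u \<alpha>\<^sub>a + \<partial>\<^sub>v \<alpha>\<^sub>f\<close>, where \<open>u = \<nabla>f(p)\<close> and \<open>v = \<nabla>a(p)\<close>. After one more derivative in the direction of a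
  third gradient, the expression is antisymmetric (modulo higher order) in \<open>a\<close> and \<open>f\<close> and symmetric
  in the two directions of differentiation. As with the Koszul formula for the Levi-Civita
  connection, this forces all second derivatives of \<open>\<alpha>\<^sub>a\<close> to have order \<open>m - 1\<close>, so \<open>\<alpha>\<^sub>a\<close> has order \<open>m + 1\<close>.
\<close>

lemma isometry_defect_vanishing:
  assumes A: "laplacian_algebra A" and reg: "regular_point A p"
    and g: "orthogonal_transformation g"
    and start: "\<And>f. f \<in> A \<Longrightarrow> pullback g f - f \<in> vanishing p (Suc (Suc 0))"
    and "f \<in> A"
  shows "pullback g f - f \<in> vanishing p (Suc (Suc m))"
  using \<open>f \<in> A\<close>
proof (induction m arbitrary: f)
  case (Suc m)
  define \<alpha> where "\<alpha> f = pullback g f - f" for f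
  have pb: "pullback g f = f + \<alpha> f" for f
    by (simp add: \<alpha>_def)
  have ord: "\<alpha> f \<in> vanishing p (Suc (Suc m))" if "f \<in> A" for f
    using Suc.IH that by (simp add: \<alpha>_def)
  have sym1: "D (grad f p) (\<alpha> a) + D (grad a p) (\<alpha> f) \<in> vanishing p (Suc (Suc m))"
    if "a \<in> A" "f \<in> A" for a f
  proof -
    let ?gp = gradient_product
    have eq: "?gp (\<alpha> a) f + ?gp a (\<alpha> f) + ?gp (\<alpha> a) (\<alpha> f) = \<alpha> (?gp a f)"
      using gradient_product_pullback[OF g, of a f]
      by (simp add: pb gradient_product_add algebra_simps)
    have v1: "\<alpha> (?gp a f) \<in> vanishing p (Suc (Suc m))"
      using ord gradient_product_closed[OF A that] by blast
    have "grad (\<alpha> f) p = 0"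
      using ord[OF that(2)] by (intro grad_eqI) simp
    then have v2: "?gp (\<alpha> a) (\<alpha> f) \<in> vanishing p (Suc (Suc m))"
      using vanishing_gradient_product[OF ord[OF that(1)], of "\<alpha> f"] by simp
    have v3: "?gp (\<alpha> a) f - D (grad f p) (\<alpha> a) \<in> vanishing p (Suc (Suc m))"
      by (rule vanishing_gradient_product[OF ord[OF that(1)]])
    have v4: "?gp a (\<alpha> f) - D (grad a p) (\<alpha> f) \<in> vanishing p (Suc (Suc m))"
      using vanishing_gradient_product[OF ord[OF that(2)], of a]
      by (simp add: gradient_product_def mult.commute)
    have "\<alpha> (?gp a f) - ?gp (\<alpha> a) (\<alpha> f) - (?gp (\<alpha> a) f - D (grad f p) (\<alpha> a))
        - (?gp a (\<alpha> f) - D (grad a p) (\<alpha> f)) \<in> vanishing p (Suc (Suc m))"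
      by (rule vanishing_diff[OF vanishing_diff[OF vanishing_diff[OF v1 v2] v3] v4])
    moreover have "\<alpha> (?gp a f) - ?gp (\<alpha> a) (\<alpha> f) - (?gp (\<alpha> a) f - D (grad f p) (\<alpha> a))
        - (?gp a (\<alpha> f) - D (grad a p) (\<alpha> f)) = D (grad f p) (\<alpha> a) + D (grad a p) (\<alpha> f)"
      by (simp add: eq[symmetric])
    ultimately show ?thesis by (simp only:)
  qed
  define S where "S a f b = D (grad b p) (D (grad f p) (\<alpha> a))" for a f b
  have S_swap: "S a f b = S a b f" for a f b
    by (simp add: S_def D_commute)
  have S_skew: "S a f b + S f a b \<in> vanishing p (Suc m)" if "a \<in> A" "f \<in> A" for a f b
  proof -
    have "D (grad b p) (D (grad f p) (\<alpha> a) + D (grad a p) (\<alpha> f)) \<in> vanishing p (Suc m)"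
      using sym1[OF that] by (subst (asm) vanishing.simps(2)) blast
    then show ?thesis by (simp add: S_def)
  qed
  have S_van: "S a f b \<in> vanishing p (Suc m)" if "a \<in> A" "f \<in> A" "b \<in> A" for a f b
  proof -
    have "(1 / 2) *\<^sub>R ((S a f b + S f a b) - (S f b a + S b f a) + (S b a f + S a b f))
        \<in> vanishing p (Suc m)"
      by (intro vanishing_scaleR vanishing_add[OF vanishing_diff] S_skew that)
    (* the combination that expresses the Christoffel symbols by derivatives of the metric *)
    moreover have "S a f b = (1 / 2) *\<^sub>R ((S a f b + S f a b) - (S f b a + S b f a) + (S b a f + S a b f))"
      unfolding S_swap[of f b a] S_swap[of b f a] S_swap[of a b f]
      by (rule polyfun_eqI) (simp add: field_simps)
    ultimately show ?thesis
      by (simp only:)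
  qed
  have "D u (D v (\<alpha> f)) \<in> vanishing p (Suc m)" for u v
    using reg S_van[OF Suc.prems] unfolding regular_point_def S_def by metis
  moreover have "ev (D v (\<alpha> f)) p = 0" "ev (\<alpha> f) p = 0" for v
    using ord[OF Suc.prems] by auto
  ultimately have "\<alpha> f \<in> vanishing p (Suc (Suc (Suc m)))"
    unfolding vanishing.simps(2)[of p "Suc (Suc m)"] vanishing.simps(2)[of p "Suc m"] by blast
  then show ?case
    by (simp only: \<alpha>_def)
qed (use start in blast)

lemma regular_fibre:
  assumes A: "laplacian_algebra A" and reg: "regular_point A p"
    and same: "\<And>f. f \<in> A \<Longrightarrow> ev f p = ev f q"
  obtains g where "g \<in> symmetry_group A" "g p = q"
proof -
  obtain g where g: "orthogonal_transformation g" "\<And>f. f \<in> A \<Longrightarrow> g (grad f p) = grad f q"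
    using gradient_isometry[OF assms] by blast
  note lin = orthogonal_transformation_linearI[OF g(1)]
  have grad_r: "grad radius_squared x = 2 *\<^sub>R x" for x :: 'a
    by (rule grad_eqI) (simp add: D_radius_squared)
  have "2 *\<^sub>R g p = 2 *\<^sub>R q"
    using g(2)[OF laplacian_algebraD(2)[OF A]] by (simp add: grad_r linear_cmul[OF lin])
  then have "g p = q"
    by simp
  have inner: "g u \<bullet> g v = u \<bullet> v" for u v
    using g(1) by (simp add: orthogonal_transformation_def)
  have start: "pullback g f - f \<in> vanishing p (Suc (Suc 0))" if "f \<in> A" for f
  proof -
    have "ev (D (g v) f) q = ev (D v f) p" for v
      using inner[of v "grad f p"] by (simp add: g(2)[OF that] inner_grad)
    then show ?thesis
      using same[OF that] by (auto simp: lin D_pullback \<open>g p = q\<close>)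
  qed
  have "pullback g f = f" if "f \<in> A" for f
  proof -
    have "pullback g f - f \<in> vanishing p m" for m
    proof -
      have "pullback g f - f \<in> vanishing p (Suc (Suc m))"
        using isometry_defect_vanishing[OF A reg g(1) start that] .
      then show ?thesis
        using vanishing_antimono[of m "Suc (Suc m)" p] by auto
    qed
    from vanishing_all_imp_zero[OF this] show ?thesis
      by simp
  qed
  with g(1) have "g \<in> symmetry_group A"
    by (simp add: symmetry_group_def)
  with \<open>g p = q\<close> that show ?thesis by blast
qed

lemma ev_symmetry:
  assumes "g \<in> symmetry_group A" "f \<in> A"
  shows "ev f (g x) = ev f x"
  using assms by (metis (mono_tags, lifting) ev_pullback mem_Collect_eq
      orthogonal_transformation_linearI symmetry_group_def)

lemma D_symmetry:
  assumes "g \<in> symmetry_group A" "f \<in> A"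
  shows "ev (D (g v) f) (g x) = ev (D v f) x"
proof -
  have lin: "linear g" and "pullback g f = f"
    using assms by (auto simp: symmetry_group_def orthogonal_transformation_linearI)
  then show ?thesis
    by (metis D_pullback ev_pullback)
qed

lemma regular_point_transfer:
  assumes A: "laplacian_algebra A" and reg: "regular_point A p"
    and same: "\<And>f. f \<in> A \<Longrightarrow> ev f p = ev f q"
  shows "regular_point A q"
proof -
  obtain g where g: "orthogonal_transformation g" "\<And>f. f \<in> A \<Longrightarrow> g (grad f p) = grad f q"
    using gradient_isometry[OF assms] by blast
  show ?thesis
    unfolding regular_point_def
  proof
    fix v
    obtain u where "v = g u"
      using orthogonal_transformation_surj[OF g(1)] by (meson surjE)
    moreover obtain f where "f \<in> A" "grad f p = u"
      using reg unfolding regular_point_def by blast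
    ultimately show "\<exists>f\<in>A. grad f q = v"
      using g(2) by metis
  qed
qed

text \<open>
  Elements of \<open>A\<close> whose gradients at \<open>z\<close> form the standard basis assemble to a map whose derivative at
  \<open>z\<close> is the identity; such a map does not take its value at \<open>z\<close> again nearby.
\<close>

lemma regular_point_isolated:
  assumes "regular_point A z"
  shows "\<not> z islimpt {x. \<forall>f\<in>A. ev f x = ev f z}"
proof
  assume lim: "z islimpt {x. \<forall>f\<in>A. ev f x = ev f z}"
  obtain F where F: "\<And>b. F b \<in> A" "\<And>b. grad (F b) z = b"
    using assms unfolding regular_point_def by metis
  define H where "H x = (\<Sum>b\<in>Basis. ev (F b) x *\<^sub>R b)" for x
  have "(H has_derivative (\<lambda>v. \<Sum>b\<in>Basis. ev (D v (F b)) z *\<^sub>R b)) (at z)"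
    unfolding H_def by (intro has_derivative_sum has_derivative_scaleR_left has_derivative_ev)
  moreover have "ev (D v (F b)) z = v \<bullet> b" for v b
    by (simp add: F flip: inner_grad)
  ultimately have "(H has_derivative (\<lambda>v. v)) (at z)"
    by (simp add: euclidean_representation)
  then obtain d where d: "d > 0"
    "\<And>y. norm (y - z) < d \<Longrightarrow> norm (H y - H z - (y - z)) \<le> (1 / 2) * norm (y - z)"
    unfolding has_derivative_at_alt by (meson half_gt_zero_iff zero_less_one)
  obtain x where x: "\<forall>f\<in>A. ev f x = ev f z" "x \<noteq> z" "dist x z < d"
    using lim \<open>d > 0\<close> unfolding islimpt_approachable by blast
  have "H x = H z"
    using x(1) F(1) by (simp add: H_def)
  with d(2)[of x] x show False
    by (simp add: dist_norm norm_minus_commute)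
qed

lemma finite_regular_fibre:
  assumes A: "laplacian_algebra A" and reg: "regular_point A p"
  shows "finite {x. \<forall>f\<in>A. ev f x = ev f p}" (is "finite ?X")
proof (rule ccontr)
  assume "infinite ?X"
  have "continuous_on UNIV (ev f)" for f :: "'a polyfun"
    by (intro continuous_at_imp_continuous_on ballI has_derivative_continuous[OF has_derivative_ev])
  then have "closed {x. ev f x = ev f p}" for f
    by (intro closed_Collect_eq continuous_on_const)
  then have "closed (\<Inter>f\<in>A. {x. ev f x = ev f p})"
    by blast
  also have "(\<Inter>f\<in>A. {x. ev f x = ev f p}) = ?X"
    by auto
  finally have "closed ?X" .
  have "?X \<subseteq> cball 0 (norm p)"
    using laplacian_algebraD(2)[OF A] by (auto simp: ev_radius_squared norm_eq_sqrt_inner)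
  then have "bounded ?X"
    by (rule bounded_subset[OF bounded_cball])
  with \<open>closed ?X\<close> have "compact ?X"
    by (simp only: compact_eq_bounded_closed)
  then obtain z where z: "z \<in> ?X" "z islimpt ?X"
    using Heine_Borel_imp_Bolzano_Weierstrass[OF _ \<open>infinite ?X\<close> subset_refl] by blast
  then have "regular_point A z"
    using regular_point_transfer[OF A reg, of z] by simp
  then have "\<not> z islimpt {x. \<forall>f\<in>A. ev f x = ev f z}"
    by (rule regular_point_isolated)
  also have "{x. \<forall>f\<in>A. ev f x = ev f z} = ?X"
    using z(1) by auto
  finally show False
    using z(2) by blast
qed

text \<open>
  The group embeds into the finite fibre through \<open>p\<close>: a symmetry transports the derivatives of elements
  of \<open>A\<close> at \<open>p\<close> to those at the image of \<open>p\<close>. Since gradients at the image fill the space, the image of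
  \<open>p\<close> determines the symmetry.
\<close>

lemma finite_symmetry_group:
  assumes A: "laplacian_algebra A" and reg: "regular_point A p"
  shows "finite (symmetry_group A)"
proof (rule finite_imageD)
  have "(\<lambda>g. g p) ` symmetry_group A \<subseteq> {x. \<forall>f\<in>A. ev f x = ev f p}"
    by (auto simp: ev_symmetry)
  then show "finite ((\<lambda>g. g p) ` symmetry_group A)"
    using finite_regular_fibre[OF assms] finite_subset by blast
  show "inj_on (\<lambda>g. g p) (symmetry_group A)"
  proof (rule inj_onI, rule ext)
    fix g h v
    assume gh: "g \<in> symmetry_group A" "h \<in> symmetry_group A" "g p = h p"
    have "regular_point A (g p)"
      using ev_symmetry[OF gh(1)] by (intro regular_point_transfer[OF A reg]) auto
    then obtain f where f: "f \<in> A" "grad f (g p) = g v - h v"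
      unfolding regular_point_def by blast
    have "g v \<bullet> grad f (g p) = h v \<bullet> grad f (g p)"
      using D_symmetry[OF gh(1) f(1), of v p] D_symmetry[OF gh(2) f(1), of v p] gh(3)
      by (simp add: inner_grad)
    then have "(g v - h v) \<bullet> (g v - h v) = 0"
      by (simp add: f(2) inner_diff_left)
    then show "g v = h v"
      by simp
  qed
qed

lemma subgroup_symmetry_group: "subgroup (symmetry_group A) orthogonal_group"
proof -
  interpret O: group "orthogonal_group :: ('a \<Rightarrow> 'a) monoid"
    by (rule group_orthogonal_group)
  have symI: "g \<in> symmetry_group A"
    if "orthogonal_transformation g" "\<And>f x. f \<in> A \<Longrightarrow> ev f (g x) = ev f x" for g
    using that by (auto simp: symmetry_group_def orthogonal_transformation_linearI intro!: polyfun_eqI)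
  show ?thesis
  proof (rule O.subgroupI)
    show "symmetry_group A \<subseteq> carrier orthogonal_group"
      by (auto simp: symmetry_group_def orthogonal_group_def)
    have "id \<in> symmetry_group A"
      by (rule symI) (auto simp: id_def)
    then show "symmetry_group A \<noteq> {}"
      by blast
  next
    fix g assume g: "g \<in> symmetry_group A"
    then have orth: "orthogonal_transformation g"
      by (simp add: symmetry_group_def)
    have inv_orth: "orthogonal_transformation (inv_into UNIV g)"
      by (rule orthogonal_transformation_inv[OF orth])
    have "inv_into UNIV g \<circ> g = id"
      using orthogonal_transformation_inj[OF orth] by (rule inv_o_cancel)
    then have "inv\<^bsub>orthogonal_group\<^esub> g = inv_into UNIV g"
      using orth inv_orth by (intro O.inv_equality) (auto simp: orthogonal_group_def)
    moreover have "inv_into UNIV g \<in> symmetry_group A"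
    proof (rule symI[OF inv_orth])
      fix f x assume "f \<in> A"
      then have "ev f (g (inv_into UNIV g x)) = ev f (inv_into UNIV g x)"
        by (rule ev_symmetry[OF g])
      then show "ev f (inv_into UNIV g x) = ev f x"
        using orthogonal_transformation_surj[OF orth] by (simp add: surj_f_inv_f)
    qed
    ultimately show "inv\<^bsub>orthogonal_group\<^esub> g \<in> symmetry_group A"
      by simp
  next
    fix g h assume gh: "g \<in> symmetry_group A" "h \<in> symmetry_group A"
    then have "g \<circ> h \<in> symmetry_group A"
      by (intro symI) (auto simp: ev_symmetry, auto simp: symmetry_group_def
          intro: orthogonal_transformation_compose)
    then show "g \<otimes>\<^bsub>orthogonal_group\<^esub> h \<in> symmetry_group A"
      by (simp add: orthogonal_group_def)
  qed
qed


section \<open>Algebraic relations by counting monomials\<close>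

definition box_monomial :: "('a \<Rightarrow> nat) \<Rightarrow> 'a::euclidean_space polyfun" where
  "box_monomial e = (\<Prod>b\<in>Basis. lin b ^ e b)"

text \<open>
  Bounding the degree in each variable separately, rather than the total degree, makes the number of
  spanning monomials \<open>(N + 1)\<^sup>n\<close>.
\<close>

definition box_poly :: "nat \<Rightarrow> 'a::euclidean_space polyfun set" where
  "box_poly N = span (box_monomial ` (PiE Basis (\<lambda>_. {..N})))"

lemma box_monomial_in: "(\<And>b. b \<in> Basis \<Longrightarrow> e b \<le> N) \<Longrightarrow> box_monomial e \<in> box_poly N"
proof -
  assume e: "\<And>b. b \<in> Basis \<Longrightarrow> e b \<le> N"
  have "box_monomial e = box_monomial (restrict e Basis)"
    by (simp add: box_monomial_def)
  moreover have "restrict e Basis \<in> PiE Basis (\<lambda>_. {..N})"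
    using e by auto
  ultimately show ?thesis
    unfolding box_poly_def by (metis image_eqI span_base)
qed

lemma box_poly_mono: "N \<le> M \<Longrightarrow> box_poly N \<subseteq> box_poly M"
  unfolding box_poly_def by (intro span_mono image_mono PiE_mono) auto

lemma box_poly_add: "f \<in> box_poly N \<Longrightarrow> g \<in> box_poly N \<Longrightarrow> f + g \<in> box_poly N"
  and box_poly_scaleR: "f \<in> box_poly N \<Longrightarrow> r *\<^sub>R f \<in> box_poly N"
  and box_poly_sum: "(\<And>i. i \<in> I \<Longrightarrow> F i \<in> box_poly N) \<Longrightarrow> sum F I \<in> box_poly N"
  unfolding box_poly_def by (auto intro: span_add span_scale span_sum)

lemma box_poly_mult:
  assumes "f \<in> box_poly N" "g \<in> box_poly M"
  shows "f * g \<in> box_poly (N + M)"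
proof -
  have mon: "box_monomial d * box_monomial e \<in> box_poly (N + M)"
    if "d \<in> PiE Basis (\<lambda>_. {..N})" "e \<in> PiE Basis (\<lambda>_. {..M})" for d e :: "'a \<Rightarrow> nat"
  proof -
    have "box_monomial d * box_monomial e = box_monomial (\<lambda>b. d b + e b)"
      by (simp add: box_monomial_def power_add prod.distrib)
    moreover have "d b + e b \<le> N + M" if "b \<in> Basis" for b
    proof (rule add_mono)
      show "d b \<le> N" using \<open>d \<in> _\<close> that by (auto dest: PiE_mem)
      show "e b \<le> M" using \<open>e \<in> _\<close> that by (auto dest: PiE_mem)
    qed
    ultimately show ?thesis
      using box_monomial_in[of "\<lambda>b. d b + e b" "N + M"] by simp
  qed
  have left: "box_monomial d * g \<in> box_poly (N + M)" if d: "d \<in> PiE Basis (\<lambda>_. {..N})" for d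
  proof -
    have "linear (\<lambda>g. box_monomial d * g)"
      by (auto intro!: linearI simp: algebra_simps)
    from linear_span_image[OF this, of "box_monomial ` PiE Basis (\<lambda>_. {..M})"]
    have "box_monomial d * g \<in> span ((\<lambda>g. box_monomial d * g) ` box_monomial ` PiE Basis (\<lambda>_. {..M}))"
      using assms(2) by (auto simp: box_poly_def)
    moreover have "span ((\<lambda>g. box_monomial d * g) ` box_monomial ` PiE Basis (\<lambda>_. {..M})) \<subseteq> box_poly (N + M)"
      using mon[OF d] by (intro span_minimal) (auto simp: box_poly_def)
    ultimately show ?thesis by blast
  qed
  have "linear (\<lambda>f. f * g)"
    by (auto intro!: linearI simp: algebra_simps)
  from linear_span_image[OF this, of "box_monomial ` PiE Basis (\<lambda>_. {..N})"]
  have "f * g \<in> span ((\<lambda>f. f * g) ` box_monomial ` PiE Basis (\<lambda>_. {..N}))"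
    using assms(1) by (auto simp: box_poly_def)
  moreover have "span ((\<lambda>f. f * g) ` box_monomial ` PiE Basis (\<lambda>_. {..N})) \<subseteq> box_poly (N + M)"
    using left by (intro span_minimal) (auto simp: box_poly_def)
  ultimately show ?thesis by blast
qed

lemma one_in_box_poly: "1 \<in> box_poly N"
  using box_monomial_in[of "\<lambda>_. 0" N] by (simp add: box_monomial_def)

lemma box_poly_power: "f \<in> box_poly N \<Longrightarrow> f ^ k \<in> box_poly (k * N)"
  by (induction k) (auto intro: one_in_box_poly box_poly_mult)

lemma box_poly_prod:
  assumes "finite I" "\<And>i. i \<in> I \<Longrightarrow> F i \<in> box_poly N"
  shows "prod F I \<in> box_poly (card I * N)"
  using assms by (induction I rule: finite_induct) (auto intro: one_in_box_poly box_poly_mult)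

lemma in_some_box_poly:
  fixes f :: "'a::euclidean_space polyfun"
  obtains N where "f \<in> box_poly N"
proof -
  have "\<exists>N. f \<in> box_poly N"
  proof (induction f rule: polyfun_induct)
    case (linear v)
    have basis: "lin b \<in> box_poly 1" if "b \<in> Basis" for b :: 'a
    proof -
      have "box_monomial (\<lambda>c. if c = b then 1 else 0) = (\<Prod>c\<in>Basis. if c = b then lin b else 1)"
        unfolding box_monomial_def by (intro prod.cong) auto
      also have "\<dots> = lin b"
        using that by simp
      finally show ?thesis
        using box_monomial_in[of "\<lambda>c. if c = b then 1 else 0" 1] by simp
    qed
    have "lin v = (\<Sum>b\<in>Basis. (v \<bullet> b) *\<^sub>R lin b)"
    proof (rule polyfun_eqI)
      fix x
      have "ev (lin v) x = (\<Sum>b\<in>Basis. (v \<bullet> b) * (x \<bullet> b))"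
        by (simp add: euclidean_inner[symmetric])
      then show "ev (lin v) x = ev (\<Sum>b\<in>Basis. (v \<bullet> b) *\<^sub>R lin b) x"
        by (simp only: ev_sum ev_simps inner_commute)
    qed
    also have "\<dots> \<in> box_poly 1"
      by (intro box_poly_sum box_poly_scaleR basis)
    finally show ?case ..
  next
    case (const c)
    show ?case
      using box_poly_scaleR[OF one_in_box_poly, of c 0] by (auto simp: of_real_def)
  next
    case (add f g)
    then obtain N M where "f \<in> box_poly N" "g \<in> box_poly M" by blast
    then have "f \<in> box_poly (max N M)" "g \<in> box_poly (max N M)"
      using box_poly_mono[of N "max N M"] box_poly_mono[of M "max N M"] by auto
    then show ?case
      using box_poly_add by blast
  next
    case (mult f g)
    then show ?case
      using box_poly_mult by blast
  qed
  then show ?thesis using that by blast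
qed

lemma linear_relation_by_counting:
  fixes v :: "'j \<Rightarrow> 'b::real_vector"
  assumes "finite J" "finite T" "card T < card J" "\<And>j. j \<in> J \<Longrightarrow> v j \<in> span T"
  obtains l where "\<exists>j\<in>J. l j \<noteq> 0" "(\<Sum>j\<in>J. l j *\<^sub>R v j) = 0"
proof (cases "inj_on v J")
  case True
  have "\<not> independent (v ` J)"
  proof
    assume "independent (v ` J)"
    then have "card (v ` J) \<le> card T"
      using independent_span_bound[of T "v ` J"] assms by auto
    then show False
      using assms(3) card_image[OF True] by simp
  qed
  then obtain u where u: "\<exists>w\<in>v ` J. u w \<noteq> 0" "(\<Sum>w\<in>v ` J. u w *\<^sub>R w) = 0"
    using dependent_finite[of "v ` J"] assms(1) by auto
  then show ?thesis
    using that[of "u \<circ> v"] by (simp add: sum.reindex[OF True])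
next
  case False
  then obtain i j where ij: "i \<in> J" "j \<in> J" "i \<noteq> j" "v i = v j"
    by (auto simp: inj_on_def)
  let ?l = "\<lambda>k. if k = i then 1 else if k = j then - 1 else 0 :: real"
  have "(\<Sum>k\<in>J. ?l k *\<^sub>R v k) = (\<Sum>k\<in>{i, j}. ?l k *\<^sub>R v k)"
    using ij assms(1) by (intro sum.mono_neutral_right) auto
  also have "\<dots> = 0"
    using ij by simp
  finally have "(\<Sum>k\<in>J. ?l k *\<^sub>R v k) = 0" .
  moreover have "\<exists>k\<in>J. ?l k \<noteq> 0"
    using ij(1) by (intro bexI[of _ i]) auto
  ultimately show ?thesis
    by (intro that[of ?l])
qed

text \<open>
  The \<open>n + 1\<close> fractions \<open>x/y\<close> and \<open>a\<^sub>i/c\<^sub>i\<close> satisfy a polynomial relation, stated here with denominators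
  cleared. With exponents below \<open>M\<close> there are \<open>M\<^sup>n\<^sup>+\<^sup>1\<close> monomials in the fractions, whereas after clearing
  denominators they lie in a space whose dimension is at most \<open>(C M)\<^sup>n\<close>, with \<open>C\<close> independent of \<open>M\<close>.
\<close>

lemma polynomial_relation_by_counting:
  fixes a c :: "'i \<Rightarrow> 'a::euclidean_space polyfun" and x y :: "'a polyfun"
  assumes "finite I" "card I = DIM('a)"
  obtains M l where "\<exists>k<M. \<exists>\<alpha>\<in>PiE I (\<lambda>_. {..<M}). l k \<alpha> \<noteq> 0"
    "(\<Sum>k<M. \<Sum>\<alpha>\<in>PiE I (\<lambda>_. {..<M}). l k \<alpha> *\<^sub>R
       (x ^ k * y ^ (M - 1 - k) * (\<Prod>i\<in>I. a i ^ \<alpha> i * c i ^ (M - 1 - \<alpha> i)))) = 0"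
proof -
  let ?n = "DIM('a)"
  define U where "U = a ` I \<union> c ` I \<union> {x, y}"
  have "finite U" using assms(1) by (simp add: U_def)
  have "\<exists>N. f \<in> box_poly N" for f :: "'a polyfun"
    using in_some_box_poly by blast
  then obtain deg where deg: "\<And>f :: 'a polyfun. f \<in> box_poly (deg f)"
    by metis
  define d where "d = Max (deg ` U)"
  have d: "f \<in> box_poly d" if "f \<in> U" for f
  proof -
    have "deg f \<le> d"
      using that \<open>finite U\<close> by (simp add: d_def)
    then show ?thesis
      using deg box_poly_mono by blast
  qed
  (* all polynomials involved have degree at most d in each variable, so M > C^n suffices *)
  define C where "C = (?n + 1) * d + 1"
  define M where "M = C ^ ?n + 1"
  define K where "K = (?n + 1) * ((M - 1) * d)"
  define J where "J = {..<M} \<times> PiE I (\<lambda>_. {..<M})"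
  define T where "T = box_monomial ` PiE (Basis :: 'a set) (\<lambda>_. {..K})"
  define v where "v = (\<lambda>(k, \<alpha>). x ^ k * y ^ (M - 1 - k) * (\<Prod>i\<in>I. a i ^ \<alpha> i * c i ^ (M - 1 - \<alpha> i)))"
  have two: "f ^ k * g ^ (M - 1 - k) \<in> box_poly ((M - 1) * d)" if "f \<in> U" "g \<in> U" "k < M" for f g k
  proof -
    have "k * d + (M - 1 - k) * d = (M - 1) * d"
      using that(3) by (simp flip: add_mult_distrib)
    then show ?thesis
      using box_poly_mult[OF box_poly_power[OF d[OF that(1)], of k] box_poly_power[OF d[OF that(2)], of "M - 1 - k"]]
      by simp
  qed
  have "v j \<in> span T" if j_in: "j \<in> J" for j
  proof -
    obtain k \<alpha> where j: "j = (k, \<alpha>)" "k < M" "\<alpha> \<in> PiE I (\<lambda>_. {..<M})"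
      using j_in by (auto simp: J_def)
    have "(\<Prod>i\<in>I. a i ^ \<alpha> i * c i ^ (M - 1 - \<alpha> i)) \<in> box_poly (card I * ((M - 1) * d))"
      using j(3) by (intro box_poly_prod two \<open>finite I\<close>) (auto simp: U_def dest: PiE_mem)
    then have "v j \<in> box_poly ((M - 1) * d + card I * ((M - 1) * d))"
      unfolding v_def j prod.case using j(2) by (intro box_poly_mult two) (auto simp: U_def)
    then show ?thesis
      by (simp add: box_poly_def T_def K_def assms(2))
  qed
  moreover have "finite J" "finite T"
    using assms(1) by (auto simp: J_def T_def intro!: finite_PiE)
  moreover have "card T < card J"
  proof -
    have "card T \<le> card (PiE (Basis :: 'a set) (\<lambda>_. {..K}))"
      unfolding T_def by (intro card_image_le finite_PiE) auto
    also have "\<dots> = (K + 1) ^ ?n"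
      by (simp add: card_PiE)
    also have "\<dots> \<le> (C * M) ^ ?n"
    proof (rule power_mono)
      have "M \<ge> 1" by (simp add: M_def)
      then have "K + 1 \<le> (?n + 1) * d * M + M"
        unfolding K_def by (intro add_mono) (auto simp: algebra_simps)
      then show "K + 1 \<le> C * M"
        by (simp add: C_def algebra_simps)
    qed auto
    also have "\<dots> = C ^ ?n * M ^ ?n"
      by (rule power_mult_distrib)
    also have "\<dots> < M * M ^ ?n"
      by (intro mult_strict_right_mono) (auto simp: M_def)
    also have "\<dots> = card J"
      using assms by (simp add: J_def card_PiE card_cartesian_product)
    finally show ?thesis .
  qed
  ultimately obtain l where l: "\<exists>j\<in>J. l j \<noteq> 0" "(\<Sum>j\<in>J. l j *\<^sub>R v j) = 0"
    using linear_relation_by_counting[of J T v] by blast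
  show ?thesis
  proof (rule that[of M "curry l"])
    show "\<exists>k<M. \<exists>\<alpha>\<in>PiE I (\<lambda>_. {..<M}). curry l k \<alpha> \<noteq> 0"
      using l(1) by (auto simp: J_def)
    show "(\<Sum>k<M. \<Sum>\<alpha>\<in>PiE I (\<lambda>_. {..<M}). curry l k \<alpha> *\<^sub>R
       (x ^ k * y ^ (M - 1 - k) * (\<Prod>i\<in>I. a i ^ \<alpha> i * c i ^ (M - 1 - \<alpha> i)))) = 0"
      using l(2) unfolding J_def v_def by (simp add: sum.cartesian_product case_prod_unfold)
  qed
qed

section \<open>Algebraic independence in the fraction field\<close>

lemma to_fract_prod: "to_fract (prod f I) = (\<Prod>i\<in>I. to_fract (f i))"
  by (induction I rule: infinite_finite_induct) auto

lemma to_fract_power: "to_fract (f ^ n) = to_fract f ^ n"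
  by (induction n) auto

lemma to_fract_scaleR: "to_fract (r *\<^sub>R f) = fract_of_real r * to_fract (f :: 'b::{idom, real_algebra_1})"
  by (simp add: fract_of_real_def scaleR_conv_of_real flip: to_fract_def)

text \<open>
  Independence as it is used below: relations indexed by an arbitrary finite set of exponent functions
  instead of finitely supported maps.
\<close>

lemma algebraically_independent_relation:
  fixes S :: "'b::{idom, real_algebra_1} fract set" and e :: "'j \<Rightarrow> 'b fract \<Rightarrow> nat"
  assumes S: "algebraically_independent S" and T: "finite T" "T \<subseteq> S" and J: "finite J"
    and inj: "\<And>i j. i \<in> J \<Longrightarrow> j \<in> J \<Longrightarrow> (\<And>s. s \<in> T \<Longrightarrow> e i s = e j s) \<Longrightarrow> i = j"
    and rel: "(\<Sum>j\<in>J. fract_of_real (l j) * (\<Prod>s\<in>T. s ^ e j s)) = 0" and "j \<in> J"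
  shows "l j = 0"
proof -
  define m where "m j = Abs_poly_mapping (\<lambda>s. if s \<in> T then e j s else 0)" for j
  have m: "Poly_Mapping.lookup (m j) = (\<lambda>s. if s \<in> T then e j s else 0)" for j
  proof -
    have "finite {s. (if s \<in> T then e j s else 0) \<noteq> 0}"
      using T(1) by (rule rev_finite_subset) auto
    then show ?thesis
      by (simp add: m_def)
  qed
  have inj_m: "inj_on m J"
  proof (rule inj_onI)
    fix i j assume ij: "i \<in> J" "j \<in> J" "m i = m j"
    then have "(\<lambda>s. if s \<in> T then e i s else 0) = (\<lambda>s. if s \<in> T then e j s else 0)"
      by (metis m)
    then have "e i s = e j s" if "s \<in> T" for s
      using that by (metis (full_types))
    with ij inj show "i = j" by blast
  qed
  define P where "P = (\<Sum>j\<in>J. Poly_Mapping.single (m j) (l j))"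
  have look: "Poly_Mapping.lookup P (m j) = l j" if "j \<in> J" for j
  proof -
    have "Poly_Mapping.lookup P (m j) = (\<Sum>i\<in>J. if i = j then l i else 0)"
      unfolding P_def lookup_sum using that inj_m
      by (intro sum.cong refl) (auto simp: lookup_single when_def inj_on_eq_iff)
    then show ?thesis
      using that J by simp
  qed
  have keys_P: "Poly_Mapping.keys P \<subseteq> m ` J"
    unfolding P_def using keys_sum[of "\<lambda>j. Poly_Mapping.single (m j) (l j)" J]
    by (auto split: if_splits)
  have keys_m: "Poly_Mapping.keys (m j) \<subseteq> T" for j
    by (auto simp: in_keys_iff m split: if_splits)
  have prod_m: "(\<Prod>s\<in>Poly_Mapping.keys (m j). s ^ Poly_Mapping.lookup (m j) s) = (\<Prod>s\<in>T. s ^ e j s)" for j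
  proof -
    have "(\<Prod>s\<in>Poly_Mapping.keys (m j). s ^ Poly_Mapping.lookup (m j) s)
        = (\<Prod>s\<in>T. s ^ Poly_Mapping.lookup (m j) s)"
      using keys_m T(1) by (intro prod.mono_neutral_left) (auto simp: in_keys_iff)
    then show ?thesis
      by (simp add: m)
  qed
  have "insertion_self P = (\<Sum>q\<in>m ` J. fract_of_real (Poly_Mapping.lookup P q) *
      (\<Prod>s\<in>Poly_Mapping.keys q. s ^ Poly_Mapping.lookup q s))"
    unfolding insertion_self_def using keys_P J
    by (intro sum.mono_neutral_left)
       (auto simp: in_keys_iff fract_of_real_def simp flip: to_fract_def)
  also have "\<dots> = (\<Sum>j\<in>J. fract_of_real (l j) * (\<Prod>s\<in>T. s ^ e j s))"
    by (simp add: sum.reindex[OF inj_m] look prod_m)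
  finally have "insertion_self P = 0"
    using rel by simp
  moreover have "Poly_Mapping.keys q \<subseteq> S" if "q \<in> Poly_Mapping.keys P" for q
    using that keys_P keys_m T(2) by blast
  ultimately have "P = 0"
    using S unfolding algebraically_independent_def by blast
  then show ?thesis
    using look[OF \<open>j \<in> J\<close>] by simp
qed

lemma clear_power_denominator:
  assumes "s * to_fract c = to_fract a" "k < M"
  shows "s ^ k * to_fract (c ^ (M - 1)) = to_fract (a ^ k * c ^ (M - 1 - k))"
proof -
  have "M - 1 = k + (M - 1 - k)"
    using assms(2) by simp
  then have "s ^ k * to_fract (c ^ (M - 1)) = (s * to_fract c) ^ k * to_fract c ^ (M - 1 - k)"
    by (simp add: to_fract_power power_mult_distrib flip: power_add)
  then show ?thesis
    by (simp add: assms(1) to_fract_power)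
qed

lemma clear_monomial_denominator:
  assumes "\<And>s. s \<in> B \<Longrightarrow> s * to_fract (c s) = to_fract (a s)" "\<alpha> \<in> PiE B (\<lambda>_. {..<M})"
  shows "(\<Prod>s\<in>B. s ^ \<alpha> s) * to_fract (\<Prod>s\<in>B. c s ^ (M - 1)) =
    to_fract (\<Prod>s\<in>B. a s ^ \<alpha> s * c s ^ (M - 1 - \<alpha> s))"
proof -
  have "(\<Prod>s\<in>B. s ^ \<alpha> s) * to_fract (\<Prod>s\<in>B. c s ^ (M - 1)) = (\<Prod>s\<in>B. s ^ \<alpha> s * to_fract (c s ^ (M - 1)))"
    by (simp add: to_fract_prod prod.distrib)
  also have "\<dots> = (\<Prod>s\<in>B. to_fract (a s ^ \<alpha> s * c s ^ (M - 1 - \<alpha> s)))"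
  proof (intro prod.cong refl clear_power_denominator)
    fix s assume "s \<in> B"
    then show "s * to_fract (c s) = to_fract (a s)" "\<alpha> s < M"
      using assms by (auto dest: PiE_mem)
  qed
  finally show ?thesis
    by (simp add: to_fract_prod)
qed

lemma algebraically_independent_dim_maximal:
  fixes S :: "'a::euclidean_space polyfun fract set"
  assumes S: "algebraically_independent S" and B: "B \<subseteq> S" "finite B" "card B = DIM('a)"
  shows "S = B"
proof (rule ccontr)
  assume "S \<noteq> B"
  then obtain t where t: "t \<in> S" "t \<notin> B"
    using B by blast
  have "\<exists>a c. s * to_fract c = to_fract a \<and> c \<noteq> 0" for s :: "'a polyfun fract"
  proof (cases s)
    case (Fract a c)
    then show ?thesis
      by (intro exI[of _ a] exI[of _ c]) (simp add: Fract_conv_to_fract)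
  qed
  then obtain a c where ac: "\<And>s :: 'a polyfun fract. s * to_fract (c s) = to_fract (a s)" "\<And>s. c s \<noteq> 0"
    by metis
  obtain M l where Ml: "\<exists>k<M. \<exists>\<alpha>\<in>PiE B (\<lambda>_. {..<M}). l k \<alpha> \<noteq> 0"
    "(\<Sum>k<M. \<Sum>\<alpha>\<in>PiE B (\<lambda>_. {..<M}). l k \<alpha> *\<^sub>R
       (a t ^ k * c t ^ (M - 1 - k) * (\<Prod>i\<in>B. a i ^ \<alpha> i * c i ^ (M - 1 - \<alpha> i)))) = 0"
    using polynomial_relation_by_counting[OF B(2,3)] .
  define J where "J = {..<M} \<times> PiE B (\<lambda>_. {..<M})"
  define e where "e = (\<lambda>(k, \<alpha>) s. if s = t then k else \<alpha> s :: nat)"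
  define Q where "Q = to_fract (c t ^ (M - 1)) * to_fract (\<Prod>s\<in>B. c s ^ (M - 1))"
  have "Q \<noteq> 0"
    using ac(2) B(2) by (auto simp: Q_def to_fract_power)
  have term_eq: "fract_of_real (l k \<alpha>) * (\<Prod>s\<in>insert t B. s ^ e (k, \<alpha>) s) * Q =
      to_fract (l k \<alpha> *\<^sub>R (a t ^ k * c t ^ (M - 1 - k) * (\<Prod>i\<in>B. a i ^ \<alpha> i * c i ^ (M - 1 - \<alpha> i))))"
    if "k < M" "\<alpha> \<in> PiE B (\<lambda>_. {..<M})" for k \<alpha>
  proof -
    have "(\<Prod>s\<in>B. s ^ e (k, \<alpha>) s) = (\<Prod>s\<in>B. s ^ \<alpha> s)"
      using t(2) by (intro prod.cong refl) (auto simp: e_def)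
    then have "(\<Prod>s\<in>insert t B. s ^ e (k, \<alpha>) s) = t ^ k * (\<Prod>s\<in>B. s ^ \<alpha> s)"
      using t(2) B(2) by (simp add: e_def)
    then have "(\<Prod>s\<in>insert t B. s ^ e (k, \<alpha>) s) * Q =
        (t ^ k * to_fract (c t ^ (M - 1))) * ((\<Prod>s\<in>B. s ^ \<alpha> s) * to_fract (\<Prod>s\<in>B. c s ^ (M - 1)))"
      by (simp add: Q_def mult_ac)
    also have "\<dots> = to_fract (a t ^ k * c t ^ (M - 1 - k)) * to_fract (\<Prod>i\<in>B. a i ^ \<alpha> i * c i ^ (M - 1 - \<alpha> i))"
      using clear_power_denominator[OF ac(1) that(1), of t]
        clear_monomial_denominator[OF ac(1) that(2)] by (simp only:)
    finally show ?thesis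
      by (simp only: to_fract_scaleR to_fract_mult mult.assoc)
  qed
  have "(\<Sum>j\<in>J. fract_of_real (case_prod l j) * (\<Prod>s\<in>insert t B. s ^ e j s)) * Q =
      (\<Sum>k<M. \<Sum>\<alpha>\<in>PiE B (\<lambda>_. {..<M}). fract_of_real (l k \<alpha>) * (\<Prod>s\<in>insert t B. s ^ e (k, \<alpha>) s) * Q)"
    unfolding sum_distrib_right J_def sum.cartesian_product by (intro sum.cong) auto
  also have "\<dots> = (\<Sum>k<M. \<Sum>\<alpha>\<in>PiE B (\<lambda>_. {..<M}). to_fract (l k \<alpha> *\<^sub>R
       (a t ^ k * c t ^ (M - 1 - k) * (\<Prod>i\<in>B. a i ^ \<alpha> i * c i ^ (M - 1 - \<alpha> i)))))"
    by (intro sum.cong refl term_eq) auto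
  also have "\<dots> = 0"
    using arg_cong[OF Ml(2), of to_fract] by (simp only: to_fract_sum to_fract_0)
  finally have "(\<Sum>j\<in>J. fract_of_real (case_prod l j) * (\<Prod>s\<in>insert t B. s ^ e j s)) = 0"
    using \<open>Q \<noteq> 0\<close> by simp
  moreover have "i = j" if "i \<in> J" "j \<in> J" and eq: "\<And>s. s \<in> insert t B \<Longrightarrow> e i s = e j s" for i j
  proof -
    obtain k \<alpha> k' \<alpha>' where ij: "i = (k, \<alpha>)" "j = (k', \<alpha>')"
      by fastforce
    have "k = k'"
      using eq[of t] by (simp add: e_def ij)
    moreover have "\<alpha> s = \<alpha>' s" if "s \<in> B" for s
      using eq[of s] that t(2) by (auto simp: e_def ij split: if_splits)
    then have "\<alpha> = \<alpha>'"
      using \<open>i \<in> J\<close> \<open>j \<in> J\<close> by (auto simp: J_def ij intro: PiE_ext)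
    ultimately show ?thesis by (simp add: ij)
  qed
  moreover have "finite J"
    using B(2) by (auto simp: J_def intro!: finite_PiE)
  ultimately have "case_prod l j = 0" if "j \<in> J" for j
    using algebraically_independent_relation[OF S, of "insert t B" J e "case_prod l" j] t(1) B(1,2) that
    by blast
  then have "l k \<alpha> = 0" if "k < M" "\<alpha> \<in> PiE B (\<lambda>_. {..<M})" for k \<alpha>
    using that by (force simp: J_def)
  with Ml(1) show False
    by blast
qed

text \<open>
  Add \<open>x\<close> to a transcendence basis and collect the resulting relation by powers of \<open>x\<close>. Some coefficient
  is nonzero because the basis is independent, and clearing denominators moves the coefficients
  from the fraction field into \<open>A\<close>.
\<close>

lemma algebraic_over_full_transcendence_degree:
  fixes A :: "'a::euclidean_space polyfun set"
  assumes A: "subalgebra A" and deg: "has_transcendence_degree (fraction_field A) DIM('a)"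
  shows "\<exists>M C. (\<forall>k. C k \<in> A) \<and> (\<exists>k<M. C k \<noteq> 0) \<and> (\<Sum>k<M. C k * x ^ k) = 0"
proof -
  obtain B where B: "B \<subseteq> fraction_field A" "algebraically_independent B" "finite B" "card B = DIM('a)"
    using deg unfolding has_transcendence_degree_def transcendence_basis_def by blast
  have "\<exists>a c. a \<in> A \<and> c \<in> A \<and> (s \<in> B \<longrightarrow> s * to_fract c = to_fract a \<and> c \<noteq> 0)" for s
  proof (cases "s \<in> B")
    case True
    then obtain a c where "s = Fract a c" "a \<in> A" "c \<in> A" "c \<noteq> 0"
      using B(1) unfolding fraction_field_def by blast
    then show ?thesis
      by (intro exI[of _ a] exI[of _ c]) (simp add: Fract_conv_to_fract)
  next
    case False
    then show ?thesis
      using subalgebraD(2)[OF A] by blast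
  qed
  then obtain a c where ac: "\<And>s. a s \<in> A" "\<And>s. c s \<in> A"
    "\<And>s. s \<in> B \<Longrightarrow> s * to_fract (c s) = to_fract (a s)" "\<And>s. s \<in> B \<Longrightarrow> c s \<noteq> 0"
    by metis
  obtain M l where Ml: "\<exists>k<M. \<exists>\<alpha>\<in>PiE B (\<lambda>_. {..<M}). l k \<alpha> \<noteq> 0"
    "(\<Sum>k<M. \<Sum>\<alpha>\<in>PiE B (\<lambda>_. {..<M}). l k \<alpha> *\<^sub>R
       (x ^ k * 1 ^ (M - 1 - k) * (\<Prod>i\<in>B. a i ^ \<alpha> i * c i ^ (M - 1 - \<alpha> i)))) = 0"
    using polynomial_relation_by_counting[OF B(3,4)] .
  define C where "C k = (\<Sum>\<alpha>\<in>PiE B (\<lambda>_. {..<M}). l k \<alpha> *\<^sub>R (\<Prod>i\<in>B. a i ^ \<alpha> i * c i ^ (M - 1 - \<alpha> i)))" for k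
  have "C k \<in> A" for k
    unfolding C_def using ac(1,2)
    by (intro subalgebra_sum[OF A] subalgebraD[OF A] subalgebra_prod[OF A] subalgebra_power[OF A])
  moreover have "\<exists>k<M. C k \<noteq> 0"
  proof (rule ccontr)
    assume neg: "\<not> ?thesis"
    obtain k \<alpha>0 where k: "k < M" "\<alpha>0 \<in> PiE B (\<lambda>_. {..<M})" "l k \<alpha>0 \<noteq> 0"
      using Ml(1) by blast
    let ?Q = "to_fract (\<Prod>s\<in>B. c s ^ (M - 1))"
    have "(\<Sum>\<alpha>\<in>PiE B (\<lambda>_. {..<M}). fract_of_real (l k \<alpha>) * (\<Prod>s\<in>B. s ^ \<alpha> s)) * ?Q = to_fract (C k)"
      unfolding C_def sum_distrib_right to_fract_sum to_fract_scaleR mult.assoc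
      by (intro sum.cong refl arg_cong[where f = "(*) _"] clear_monomial_denominator ac(3)) auto
    also have "\<dots> = 0"
      using neg k(1) by simp
    moreover have "?Q \<noteq> 0"
      using ac(4) B(3) by simp
    ultimately have "(\<Sum>\<alpha>\<in>PiE B (\<lambda>_. {..<M}). fract_of_real (l k \<alpha>) * (\<Prod>s\<in>B. s ^ \<alpha> s)) = 0"
      by simp
    note rel = this
    have fin: "finite (PiE B (\<lambda>_. {..<M}))"
      using B(3) by (intro finite_PiE) auto
    have inj: "\<alpha> = \<beta>" if "\<alpha> \<in> PiE B (\<lambda>_. {..<M})" "\<beta> \<in> PiE B (\<lambda>_. {..<M})"
        "\<And>s. s \<in> B \<Longrightarrow> \<alpha> s = \<beta> s" for \<alpha> \<beta>
      using that by (rule PiE_ext)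
    have "l k \<alpha>0 = 0"
      by (rule algebraically_independent_relation[OF B(2) B(3) subset_refl fin inj rel k(2)])
    with k(3) show False by blast
  qed
  moreover have "(\<Sum>k<M. C k * x ^ k) = 0"
  proof -
    have "(\<Sum>k<M. C k * x ^ k) = (\<Sum>k<M. \<Sum>\<alpha>\<in>PiE B (\<lambda>_. {..<M}). l k \<alpha> *\<^sub>R
       (x ^ k * 1 ^ (M - 1 - k) * (\<Prod>i\<in>B. a i ^ \<alpha> i * c i ^ (M - 1 - \<alpha> i))))"
      by (simp add: C_def sum_distrib_left mult.commute)
    then show ?thesis
      using Ml(2) by simp
  qed
  ultimately show ?thesis
    by blast
qed


section \<open>Algebraic independence from independent differentials\<close>

lemma vanishing_power_mult:
  assumes "ev F p = 0" "f \<in> vanishing p m"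
  shows "F ^ n * f \<in> vanishing p (n + m)"
proof (induction n)
  case (Suc n)
  then show ?case
    using vanishing_mult_one[OF Suc assms(1)] by (simp add: mult.assoc)
qed (simp add: assms)

lemma monomial_vanishing:
  assumes "finite B" "\<And>b. b \<in> B \<Longrightarrow> ev (F b) p = 0"
  shows "(\<Prod>b\<in>B. F b ^ e b) \<in> vanishing p (\<Sum>b\<in>B. e b)"
  using assms by (induction B rule: finite_induct) (auto intro: vanishing_power_mult)

text \<open>
  To leading order, polynomials \<open>F\<^sub>b\<close> with \<open>F\<^sub>b(p) = 0\<close> and \<open>\<partial>\<^sub>c F\<^sub>b(p) = \<delta>\<^sub>b\<^sub>c\<close> behave under \<open>\<partial>\<^sub>c\<close> like coordinates
  centred at \<open>p\<close>. The product ranges over an arbitrary finite set to permit induction.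
\<close>

lemma D_monomial_leading:
  assumes "finite B" "\<And>b. b \<in> B \<Longrightarrow> ev (F b) p = 0"
    and dF: "\<And>b. b \<in> B \<Longrightarrow> ev (D c (F b)) p = (if b = c then 1 else 0)"
  shows "D c (\<Prod>b\<in>B. F b ^ e b)
      - (if c \<in> B then real (e c) else 0) *\<^sub>R (\<Prod>b\<in>B. F b ^ (e(c := e c - 1)) b)
    \<in> vanishing p (\<Sum>b\<in>B. e b)"
  using assms
proof (induction B rule: finite_induct)
  case (insert b B)
  define Q where "Q = (\<Prod>b\<in>B. F b ^ e b)"
  define T where "T = (if c \<in> B then real (e c) else 0) *\<^sub>R (\<Prod>b\<in>B. F b ^ (e(c := e c - 1)) b)"
  define s where "s = (\<Sum>b\<in>B. e b)"
  define \<delta> where "\<delta> = (if b = c then 1 else 0 :: real)"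
  let ?X = "of_nat (e b) * (F b ^ (e b - 1) * ((D c (F b) - of_real \<delta>) * Q))"
  have Q: "Q \<in> vanishing p s"
    unfolding Q_def s_def using insert by (intro monomial_vanishing) auto
  have IH: "D c Q - T \<in> vanishing p s"
    unfolding Q_def T_def s_def using insert by blast
  have target: "(if c \<in> insert b B then real (e c) else 0) *\<^sub>R (\<Prod>b\<in>insert b B. F b ^ (e(c := e c - 1)) b)
      = of_nat (e b) * (F b ^ (e b - 1) * (of_real \<delta> * Q)) + F b ^ e b * T"
  proof (cases "b = c")
    case True
    have "(\<Prod>b\<in>B. F b ^ (e(c := e c - 1)) b) = Q"
      unfolding Q_def using insert.hyps(2) True by (intro prod.cong) auto
    then show ?thesis
      using True insert.hyps by (simp add: \<delta>_def T_def scaleR_polyfun_eq)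
  next
    case False
    then show ?thesis
      using insert.hyps by (simp add: \<delta>_def T_def)
  qed
  have "D c (\<Prod>b\<in>insert b B. F b ^ e b) = D c (F b ^ e b * Q)"
    using insert.hyps by (simp add: Q_def)
  also have "\<dots> = ?X + of_nat (e b) * (F b ^ (e b - 1) * (of_real \<delta> * Q)) + F b ^ e b * D c Q"
    by (simp add: D_mult D_power algebra_simps)
  finally have "D c (\<Prod>b\<in>insert b B. F b ^ e b)
      - (if c \<in> insert b B then real (e c) else 0) *\<^sub>R (\<Prod>b\<in>insert b B. F b ^ (e(c := e c - 1)) b)
      = ?X + F b ^ e b * (D c Q - T)"
    unfolding target by (simp add: algebra_simps)
  moreover have "?X \<in> vanishing p (e b + s)"
  proof (cases "e b")
    case 0
    then show ?thesis by (simp add: vanishing_zero)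
  next
    case (Suc n)
    have "ev (D c (F b) - of_real \<delta>) p = 0"
      using insert.prems by (simp add: \<delta>_def)
    from vanishing_mult_one[OF Q this]
    have "F b ^ n * ((D c (F b) - of_real \<delta>) * Q) \<in> vanishing p (n + Suc s)"
      using insert.prems by (intro vanishing_power_mult) auto
    then show ?thesis
      using vanishing_mult[of _ p "n + Suc s" "of_nat (e b)"] by (simp add: Suc)
  qed
  moreover have "F b ^ e b * (D c Q - T) \<in> vanishing p (e b + s)"
    using insert.prems by (intro vanishing_power_mult IH) auto
  moreover have "(\<Sum>b\<in>insert b B. e b) = e b + s"
    using insert.hyps by (simp add: s_def)
  ultimately show ?case
    by (simp only: vanishing_add)
qed auto

text \<open>
  Differentiating in a direction \<open>c\<close> lowers both the degree of the monomials and the order of vanishing by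
  one, and keeps the exponent functions with nonzero \<open>c\<close>-entry distinct.
\<close>

lemma leading_terms_independent:
  fixes F :: "'a::euclidean_space \<Rightarrow> 'a polyfun"
  assumes F: "\<And>b. b \<in> Basis \<Longrightarrow> ev (F b) p = 0" "\<And>b. b \<in> Basis \<Longrightarrow> grad (F b) p = b"
    and J: "finite J" "\<And>i j. i \<in> J \<Longrightarrow> j \<in> J \<Longrightarrow> (\<And>b. b \<in> Basis \<Longrightarrow> e i b = e j b) \<Longrightarrow> i = j"
    and deg: "\<And>j. j \<in> J \<Longrightarrow> (\<Sum>b\<in>Basis. e j b) = k"
    and van: "(\<Sum>j\<in>J. l j *\<^sub>R (\<Prod>b\<in>Basis. F b ^ e j b)) \<in> vanishing p (Suc k)"
    and "j \<in> J"
  shows "l j = 0"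
  using J deg van \<open>j \<in> J\<close>
proof (induction k arbitrary: J e l j)
  case 0
  have e0: "e i b = 0" if "i \<in> J" "b \<in> Basis" for i b
    using 0(3)[OF that(1)] that(2) by simp
  have "i = j" if "i \<in> J" for i
    using 0(2)[OF that 0(5)] e0[OF that] e0[OF 0(5)] by simp
  then have "J = {j}"
    using 0(5) by blast
  then show ?case
    using 0(4) e0 by simp
next
  case (Suc k)
  have "\<exists>c\<in>Basis. e j c \<noteq> 0"
    using Suc.prems(3)[OF Suc.prems(5)] by (metis nat.distinct(1) sum.neutral)
  then obtain c where c: "c \<in> Basis" "e j c \<noteq> 0"
    by blast
  define m where "m i = (\<Prod>b\<in>Basis. F b ^ e i b)" for i
  define e' where "e' i = (e i)(c := e i c - 1)" for i
  define m' where "m' i = (\<Prod>b\<in>Basis. F b ^ e' i b)" for i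
  define J' where "J' = {i\<in>J. e i c \<noteq> 0}"
  have dF: "ev (D c (F b)) p = (if b = c then 1 else 0)" if "b \<in> Basis" for b
    using F(2)[OF that] that c(1) by (simp add: inner_Basis flip: inner_grad)
  have "D c (m i) - real (e i c) *\<^sub>R m' i \<in> vanishing p (Suc k)" if "i \<in> J" for i
    using D_monomial_leading[of Basis F p c "e i"] F(1) dF c(1) Suc.prems(3)[OF that]
    by (simp add: m_def m'_def e'_def)
  then have "(\<Sum>i\<in>J. l i *\<^sub>R (D c (m i) - real (e i c) *\<^sub>R m' i)) \<in> vanishing p (Suc k)"
    by (intro vanishing_sum vanishing_scaleR)
  moreover have "D c (\<Sum>i\<in>J. l i *\<^sub>R m i) \<in> vanishing p (Suc k)"
    using Suc.prems(4) unfolding m_def by (subst (asm) vanishing.simps(2)) blast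
  ultimately have "D c (\<Sum>i\<in>J. l i *\<^sub>R m i)
      - (\<Sum>i\<in>J. l i *\<^sub>R (D c (m i) - real (e i c) *\<^sub>R m' i)) \<in> vanishing p (Suc k)"
    by (rule vanishing_diff[rotated])
  moreover have "D c (\<Sum>i\<in>J. l i *\<^sub>R m i)
      - (\<Sum>i\<in>J. l i *\<^sub>R (D c (m i) - real (e i c) *\<^sub>R m' i)) = (\<Sum>i\<in>J. (l i * real (e i c)) *\<^sub>R m' i)"
    by (simp add: scaleR_diff_right sum_subtractf)
  moreover have "(\<Sum>i\<in>J. (l i * real (e i c)) *\<^sub>R m' i) = (\<Sum>i\<in>J'. (l i * real (e i c)) *\<^sub>R m' i)"
    using Suc.prems(1) by (intro sum.mono_neutral_right) (auto simp: J'_def)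
  ultimately have van': "(\<Sum>i\<in>J'. (l i * real (e i c)) *\<^sub>R (\<Prod>b\<in>Basis. F b ^ e' i b)) \<in> vanishing p (Suc k)"
    by (simp only: m'_def)
  have "i = i'" if "i \<in> J'" "i' \<in> J'" and eq: "\<And>b. b \<in> Basis \<Longrightarrow> e' i b = e' i' b" for i i'
  proof (rule Suc.prems(2))
    show "i \<in> J" "i' \<in> J" using that by (auto simp: J'_def)
    fix b :: 'a assume "b \<in> Basis"
    then show "e i b = e i' b"
      using eq[of b] that(1,2) by (auto simp: e'_def J'_def split: if_splits)
  qed
  moreover have "(\<Sum>b\<in>Basis. e' i b) = k" if "i \<in> J'" for i
  proof -
    have "(\<Sum>b\<in>Basis. e i b) = e i c + (\<Sum>b\<in>Basis - {c}. e i b)"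
      using c(1) by (simp add: sum.remove)
    moreover have "(\<Sum>b\<in>Basis. e' i b) = e' i c + (\<Sum>b\<in>Basis - {c}. e' i b)"
      using c(1) by (simp add: sum.remove)
    moreover have "(\<Sum>b\<in>Basis - {c}. e' i b) = (\<Sum>b\<in>Basis - {c}. e i b)"
      by (intro sum.cong) (auto simp: e'_def)
    ultimately show ?thesis
      using Suc.prems(3)[of i] that by (simp add: e'_def J'_def)
  qed
  moreover have "finite J'" "j \<in> J'"
    using Suc.prems(1,5) c(2) by (auto simp: J'_def)
  ultimately have "l j * real (e j c) = 0"
    using Suc.IH[of J' e' "\<lambda>i. l i * real (e i c)" j] van' by blast
  then show ?case
    using c(2) by simp
qed

text \<open>
  In a relation, the terms of least degree must cancel up to higher order at \<open>p\<close>.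
\<close>

lemma monomials_independent:
  fixes F :: "'a::euclidean_space \<Rightarrow> 'a polyfun"
  assumes F: "\<And>b. b \<in> Basis \<Longrightarrow> ev (F b) p = 0" "\<And>b. b \<in> Basis \<Longrightarrow> grad (F b) p = b"
    and J: "finite J" "\<And>i j. i \<in> J \<Longrightarrow> j \<in> J \<Longrightarrow> (\<And>b. b \<in> Basis \<Longrightarrow> e i b = e j b) \<Longrightarrow> i = j"
    and rel: "(\<Sum>j\<in>J. l j *\<^sub>R (\<Prod>b\<in>Basis. F b ^ e j b)) = 0"
    and "j \<in> J"
  shows "l j = 0"
proof (rule ccontr)
  assume "l j \<noteq> 0"
  define m where "m i = (\<Prod>b\<in>Basis. F b ^ e i b)" for i
  define deg where "deg i = (\<Sum>b\<in>Basis. e i b)" for i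
  define J0 where "J0 = {i\<in>J. l i \<noteq> 0}"
  define k where "k = Min (deg ` J0)"
  define J1 where "J1 = {i\<in>J0. deg i = k}"
  have J0: "finite J0" "J0 \<noteq> {}"
    using J(1) \<open>j \<in> J\<close> \<open>l j \<noteq> 0\<close> by (auto simp: J0_def)
  have "k \<in> deg ` J0"
    unfolding k_def using J0 by (intro Min_in) auto
  then obtain j1 where j1: "j1 \<in> J1"
    by (auto simp: J1_def)
  have "0 = (\<Sum>i\<in>J. l i *\<^sub>R m i)"
    using rel by (simp add: m_def)
  also have "\<dots> = (\<Sum>i\<in>J0. l i *\<^sub>R m i)"
    using J(1) by (intro sum.mono_neutral_right) (auto simp: J0_def)
  also have "\<dots> = (\<Sum>i\<in>J0 - J1. l i *\<^sub>R m i) + (\<Sum>i\<in>J1. l i *\<^sub>R m i)"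
    using J0(1) by (intro sum.subset_diff) (auto simp: J1_def)
  finally have "(\<Sum>i\<in>J1. l i *\<^sub>R m i) = 0 - (\<Sum>i\<in>J0 - J1. l i *\<^sub>R m i)"
    by (simp add: eq_neg_iff_add_eq_0 add.commute)
  moreover have "m i \<in> vanishing p (Suc k)" if "i \<in> J0 - J1" for i
  proof -
    have "k \<le> deg i"
      unfolding k_def using that J0(1) by (intro Min_le) auto
    then have "Suc k \<le> deg i"
      using that by (auto simp: J1_def)
    moreover have "m i \<in> vanishing p (deg i)"
      unfolding m_def deg_def by (intro monomial_vanishing F) auto
    ultimately show ?thesis
      using vanishing_antimono by blast
  qed
  then have "0 - (\<Sum>i\<in>J0 - J1. l i *\<^sub>R m i) \<in> vanishing p (Suc k)"
    by (intro vanishing_diff vanishing_zero vanishing_sum vanishing_scaleR)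
  ultimately have "(\<Sum>i\<in>J1. l i *\<^sub>R m i) \<in> vanishing p (Suc k)"
    by (simp only:)
  then have van: "(\<Sum>i\<in>J1. l i *\<^sub>R (\<Prod>b\<in>Basis. F b ^ e i b)) \<in> vanishing p (Suc k)"
    by (simp only: m_def)
  have fin: "finite J1"
    using J0(1) by (simp add: J1_def)
  have inj: "i = i'" if "i \<in> J1" "i' \<in> J1" "\<And>b. b \<in> Basis \<Longrightarrow> e i b = e i' b" for i i'
    using that by (intro J(2)) (auto simp: J1_def J0_def)
  have deg_k: "(\<Sum>b\<in>Basis. e i b) = k" if "i \<in> J1" for i
    using that by (simp add: J1_def deg_def)
  have "l j1 = 0"
    by (rule leading_terms_independent[OF F fin inj deg_k van j1])
  then show False
    using j1 by (simp add: J1_def J0_def)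
qed

lemma transcendence_degree_from_coordinates:
  fixes A :: "'a::euclidean_space polyfun set"
  assumes F: "\<And>b. b \<in> Basis \<Longrightarrow> ev (F b) p = 0" "\<And>b. b \<in> Basis \<Longrightarrow> grad (F b) p = b"
    and A: "1 \<in> A" "\<And>b. b \<in> Basis \<Longrightarrow> F b \<in> A"
  shows "has_transcendence_degree (fraction_field A) DIM('a)"
proof -
  define B where "B = (\<lambda>b. to_fract (F b)) ` Basis"
  have inj: "inj_on (\<lambda>b. to_fract (F b)) Basis"
    by (rule inj_onI) (metis F(2) to_fract_eq_iff)
  have B: "finite B" "card B = DIM('a)"
    by (auto simp: B_def card_image[OF inj])
  have "B \<subseteq> fraction_field A"
    using A unfolding B_def fraction_field_def to_fract_def by force
  moreover have "algebraically_independent B"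
    unfolding algebraically_independent_def
  proof (intro allI impI, elim conjE)
    fix P :: "('a polyfun fract \<Rightarrow>\<^sub>0 nat) \<Rightarrow>\<^sub>0 real"
    assume keys: "\<forall>m\<in>Poly_Mapping.keys P. Poly_Mapping.keys m \<subseteq> B" and "insertion_self P = 0"
    define e where "e m b = Poly_Mapping.lookup m (to_fract (F b))"
      for m :: "'a polyfun fract \<Rightarrow>\<^sub>0 nat" and b
    define l where "l = Poly_Mapping.lookup P"
    have "fract_of_real (l m) * (\<Prod>s\<in>Poly_Mapping.keys m. s ^ Poly_Mapping.lookup m s) =
        to_fract (l m *\<^sub>R (\<Prod>b\<in>Basis. F b ^ e m b))" if "m \<in> Poly_Mapping.keys P" for m
    proof -
      have "(\<Prod>s\<in>Poly_Mapping.keys m. s ^ Poly_Mapping.lookup m s) = (\<Prod>s\<in>B. s ^ Poly_Mapping.lookup m s)"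
        using keys that B(1) by (intro prod.mono_neutral_left) (auto simp: in_keys_iff)
      also have "\<dots> = (\<Prod>b\<in>Basis. to_fract (F b) ^ e m b)"
        unfolding B_def by (simp add: prod.reindex[OF inj] e_def)
      finally show ?thesis
        by (simp add: to_fract_scaleR to_fract_prod to_fract_power)
    qed
    then have "insertion_self P = to_fract (\<Sum>m\<in>Poly_Mapping.keys P. l m *\<^sub>R (\<Prod>b\<in>Basis. F b ^ e m b))"
      unfolding insertion_self_def to_fract_sum l_def by (intro sum.cong) auto
    then have rel: "(\<Sum>m\<in>Poly_Mapping.keys P. l m *\<^sub>R (\<Prod>b\<in>Basis. F b ^ e m b)) = 0"
      using \<open>insertion_self P = 0\<close> by (simp del: to_fract_sum)
    have inj_e: "m = m'" if m: "m \<in> Poly_Mapping.keys P" "m' \<in> Poly_Mapping.keys P"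
        "\<And>b. b \<in> Basis \<Longrightarrow> e m b = e m' b" for m m'
    proof (rule poly_mapping_eqI)
      fix s
      show "Poly_Mapping.lookup m s = Poly_Mapping.lookup m' s"
      proof (cases "s \<in> B")
        case True
        then show ?thesis
          using m(3) by (auto simp: B_def e_def)
      next
        case False
        then show ?thesis
          using keys m(1,2) by (metis in_keys_iff subsetD)
      qed
    qed
    have "l m = 0" if "m \<in> Poly_Mapping.keys P" for m
      by (rule monomials_independent[OF F finite_keys inj_e rel that])
    then have "Poly_Mapping.lookup P m = 0" for m
      unfolding l_def in_keys_iff by blast
    then show "P = 0"
      by (intro poly_mapping_eqI) simp
  qed
  moreover have "C = B" if "B \<subseteq> C" "algebraically_independent C" for C
    using algebraically_independent_dim_maximal[OF that(2) that(1) B] .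
  ultimately show ?thesis
    using B unfolding has_transcendence_degree_def transcendence_basis_def by blast
qed

section \<open>Invariant rings of finite orthogonal groups\<close>

lemma laplacian_algebra_invariant_ring:
  assumes orth: "\<And>g. g \<in> \<Gamma> \<Longrightarrow> orthogonal_transformation g"
  shows "laplacian_algebra (invariant_ring \<Gamma>)"
proof -
  have lin: "linear g" if "g \<in> \<Gamma>" for g
    using orth[OF that] by (rule orthogonal_transformation_linearI)
  have eq: "f \<in> invariant_ring \<Gamma> \<longleftrightarrow> (\<forall>g\<in>\<Gamma>. pullback g f = f)" for f
    unfolding invariant_ring_def using lin by (auto intro!: polyfun_eqI) (metis ev_pullback)
  have "g v \<bullet> g v = v \<bullet> v" if "g \<in> \<Gamma>" for g v
    using orth[OF that] by (simp add: orthogonal_transformation_def)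
  then have "radius_squared \<in> invariant_ring \<Gamma>"
    by (simp add: invariant_ring_def ev_radius_squared)
  moreover have "laplacian f \<in> invariant_ring \<Gamma>" if "f \<in> invariant_ring \<Gamma>" for f
    using that orth unfolding eq by (metis laplacian_pullback)
  moreover have "subalgebra (invariant_ring \<Gamma>)"
    by (auto simp: subalgebra_def subspace_def invariant_ring_def)
  ultimately show ?thesis
    by (simp add: laplacian_algebra_def)
qed

text \<open>
  If \<open>f(g x) \<noteq> f(x)\<close> with \<open>f\<close> homogeneous, then the same holds for \<open>x\<close> scaled to unit length, and \<open>x\<close> and
  \<open>g x\<close> are not distinguished by invariants.
\<close>

lemma maximal_algebra_invariant_ring:
  fixes \<Gamma> :: "('a::euclidean_space \<Rightarrow> 'a) set"
  assumes orth: "\<And>g. g \<in> \<Gamma> \<Longrightarrow> orthogonal_transformation g"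
  shows "maximal_algebra (invariant_ring \<Gamma>)"
  unfolding maximal_algebra_def
proof (intro conjI allI impI)
  show "subalgebra (invariant_ring \<Gamma>)"
    using laplacian_algebra_invariant_ring[of \<Gamma>] orth by (simp add: laplacian_algebra_def)
next
  fix d :: nat and f
  assume "homogeneous d f \<and> f \<notin> invariant_ring \<Gamma>"
  then obtain g x where f: "homogeneous d f" and g: "g \<in> \<Gamma>" "ev f (g x) \<noteq> ev f x"
    by (auto simp: invariant_ring_def)
  have lin: "linear g" and iso: "norm (g v) = norm v" for v
    using orth[OF g(1)] by (auto simp: orthogonal_transformation)
  have "x \<noteq> 0"
    using g(2) linear_0[OF lin] by auto
  define p where "p = (1 / norm x) *\<^sub>R x"
  have "p \<in> sphere 0 1" "g p \<in> sphere 0 1"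
    using \<open>x \<noteq> 0\<close> by (auto simp: iso p_def)
  then have "sphere_equiv (invariant_ring \<Gamma>) p (g p)"
    using g(1) by (simp add: sphere_equiv_def invariant_ring_def)
  moreover have "ev f p \<noteq> ev f (g p)"
    using f g(2) \<open>x \<noteq> 0\<close> by (simp add: p_def linear_cmul[OF lin] homogeneous_def)
  ultimately show "\<exists>p q. sphere_equiv (invariant_ring \<Gamma>) p q \<and> ev f p \<noteq> ev f q"
    by blast
qed

text \<open>
  Each nontrivial \<open>g\<close> has a coordinate of \<open>g x - x\<close> that is a nonzero polynomial in \<open>x\<close>; the product of
  these finitely many polynomials is nonzero and hence nonzero somewhere.
\<close>

lemma point_with_trivial_stabilizer:
  fixes \<Gamma> :: "('a::euclidean_space \<Rightarrow> 'a) set"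
  assumes "finite \<Gamma>" and lin: "\<And>g. g \<in> \<Gamma> \<Longrightarrow> linear g"
  obtains p where "\<And>g. g \<in> \<Gamma> \<Longrightarrow> g \<noteq> id \<Longrightarrow> g p \<noteq> p"
proof -
  have "\<exists>h. h \<noteq> 0 \<and> (\<forall>p. g p = p \<longrightarrow> ev h p = 0)" if g: "g \<in> \<Gamma> - {id}" for g
  proof -
    obtain x where "g x \<noteq> x"
      using g by (auto simp: fun_eq_iff)
    then obtain b where b: "b \<bullet> g x \<noteq> b \<bullet> x"
      by (metis vector_eq_ldot)
    define h where "h = pullback g (lin b) - lin b"
    have ev_h: "ev h y = b \<bullet> g y - b \<bullet> y" for y
      using lin g by (simp add: h_def)
    then have "h \<noteq> 0"
      using b by (metis eq_iff_diff_eq_0 zero_polyfun.rep_eq)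
    then show ?thesis
      using ev_h by (intro exI[of _ h]) auto
  qed
  then obtain h where h: "\<And>g. g \<in> \<Gamma> - {id} \<Longrightarrow> h g \<noteq> 0"
    "\<And>g p. g \<in> \<Gamma> - {id} \<Longrightarrow> g p = p \<Longrightarrow> ev (h g) p = 0"
    by metis
  have "(\<Prod>g\<in>\<Gamma> - {id}. h g) \<noteq> 0"
    using h(1) assms(1) by simp
  then obtain p where "ev (\<Prod>g\<in>\<Gamma> - {id}. h g) p \<noteq> 0"
    by (rule polyfun_nonzeroE)
  then have "ev (h g) p \<noteq> 0" if "g \<in> \<Gamma> - {id}" for g
    using that assms(1) by simp
  then show ?thesis
    using h(2) by (intro that[of p]) blast
qed

lemma sum_translate_closed:
  assumes "finite \<Gamma>" "\<And>g k. g \<in> \<Gamma> \<Longrightarrow> k \<in> \<Gamma> \<Longrightarrow> g \<circ> k \<in> \<Gamma>" "k \<in> \<Gamma>" "surj k"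
  shows "(\<Sum>g\<in>\<Gamma>. \<phi> (g \<circ> k)) = (\<Sum>g\<in>\<Gamma>. \<phi> g)"
proof -
  have inj: "inj_on (\<lambda>g. g \<circ> k) \<Gamma>"
    by (rule inj_onI) (use assms(4) in \<open>simp add: surj_fun_eq\<close>)
  then have "(\<lambda>g. g \<circ> k) ` \<Gamma> = \<Gamma>"
    using assms by (intro endo_inj_surj) auto
  then show ?thesis
    using sum.reindex[OF inj, of \<phi>] by (simp add: o_def)
qed

text \<open>
  Average over \<open>\<Gamma>\<close> the coordinate \<open>\<langle>b, x - p\<rangle>\<close> multiplied by a polynomial \<open>h\<close> with \<open>h(p) \<noteq> 0\<close> that
  vanishes to second order at the other points of the orbit of \<open>p\<close>. At \<open>p\<close> only the summand of the
  identity then contributes to the first derivative.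
\<close>

lemma invariant_local_coordinates:
  fixes \<Gamma> :: "('a::euclidean_space \<Rightarrow> 'a) set"
  assumes fin: "finite \<Gamma>" and orth: "\<And>g. g \<in> \<Gamma> \<Longrightarrow> orthogonal_transformation g"
    and idG: "id \<in> \<Gamma>" and comp: "\<And>g k. g \<in> \<Gamma> \<Longrightarrow> k \<in> \<Gamma> \<Longrightarrow> g \<circ> k \<in> \<Gamma>"
  shows "\<exists>F p. \<forall>b. F b \<in> invariant_ring \<Gamma> \<and> ev (F b) p = 0 \<and> grad (F b) p = b"
proof -
  have lin: "linear g" if "g \<in> \<Gamma>" for g
    using orth[OF that] by (rule orthogonal_transformation_linearI)
  obtain p where p: "\<And>g. g \<in> \<Gamma> \<Longrightarrow> g \<noteq> id \<Longrightarrow> g p \<noteq> p"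
    using point_with_trivial_stabilizer[OF fin lin] by blast
  define sq where "sq g = (\<Sum>c\<in>Basis. (lin c - of_real (c \<bullet> g p))\<^sup>2)" for g :: "'a \<Rightarrow> 'a"
  have ev_sq: "ev (sq g) x = (x - g p) \<bullet> (x - g p)" for g x
  proof -
    have "ev (sq g) x = (\<Sum>c\<in>Basis. ((x - g p) \<bullet> c) * ((x - g p) \<bullet> c))"
      by (simp add: sq_def power2_eq_square inner_commute[of _ x] inner_commute[of _ "g p"] inner_diff_left)
    then show ?thesis
      by (simp only: euclidean_inner[symmetric])
  qed
  have sq_van: "sq g \<in> vanishing (g p) 2" for g
    unfolding sq_def power2_eq_square numeral_2_eq_2
    by (intro vanishing_sum) (auto simp: D_mult)
  define h where "h = (\<Prod>g\<in>\<Gamma> - {id}. sq g)"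
  have h_p: "ev h p \<noteq> 0"
  proof -
    have "p \<noteq> g p" if "g \<in> \<Gamma> - {id}" for g
      using p[of g] that by force
    then show ?thesis
      using fin by (auto simp: h_def ev_sq)
  qed
  have h_van: "h \<in> vanishing (g p) 2" if "g \<in> \<Gamma> - {id}" for g
  proof -
    have "h = (\<Prod>k\<in>\<Gamma> - {id} - {g}. sq k) * sq g"
      unfolding h_def using fin that by (subst prod.remove[of _ g]) (auto simp: mult.commute)
    then show ?thesis
      using vanishing_mult[OF sq_van] by metis
  qed
  define G where "G b = (lin b - of_real (b \<bullet> p)) * h" for b
  have G_van: "G b \<in> vanishing (g p) 2" if "g \<in> \<Gamma> - {id}" for b g
    unfolding G_def by (intro vanishing_mult h_van that)
  have G0: "ev (G b) (g p) = 0" if "g \<in> \<Gamma>" for b g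
    using G_van[of g b] that by (cases "g = id") (auto simp: G_def numeral_2_eq_2)
  have G1: "ev (D v (G b)) (g p) = (if g = id then ev h p * (b \<bullet> v) else 0)" if "g \<in> \<Gamma>" for b g v
    using G_van[of g b] that by (auto simp: G_def numeral_2_eq_2 D_mult)
  define F where "F b = (1 / ev h p) *\<^sub>R (\<Sum>g\<in>\<Gamma>. pullback g (G b))" for b
  have ev_F: "ev (F b) x = (1 / ev h p) * (\<Sum>g\<in>\<Gamma>. ev (G b) (g x))" for b x
    by (simp add: F_def lin)
  have "F b \<in> invariant_ring \<Gamma>" for b
    unfolding invariant_ring_def
  proof (intro CollectI ballI allI)
    fix k x assume k: "k \<in> \<Gamma>"
    have "(\<Sum>g\<in>\<Gamma>. ev (G b) ((g \<circ> k) x)) = (\<Sum>g\<in>\<Gamma>. ev (G b) (g x))"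
      using sum_translate_closed[OF fin comp k orthogonal_transformation_surj[OF orth[OF k]],
          of "\<lambda>g. ev (G b) (g x)"] by simp
    then show "ev (F b) (k x) = ev (F b) x"
      by (simp add: ev_F)
  qed
  moreover have "ev (F b) p = 0" for b
    by (simp add: ev_F G0)
  moreover have "grad (F b) p = b" for b
  proof (rule grad_eqI)
    fix v
    have "ev (D v (F b)) p = (1 / ev h p) * (\<Sum>g\<in>\<Gamma>. ev (D (g v) (G b)) (g p))"
      by (simp add: F_def lin D_pullback)
    also have "(\<Sum>g\<in>\<Gamma>. ev (D (g v) (G b)) (g p)) = (\<Sum>g\<in>\<Gamma>. if g = id then ev h p * (b \<bullet> v) else 0)"
      by (intro sum.cong refl) (simp add: G1)
    also have "\<dots> = ev h p * (b \<bullet> v)"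
      using fin idG by simp
    finally show "ev (D v (F b)) p = v \<bullet> b"
      using h_p by (simp add: inner_commute)
  qed
  ultimately show ?thesis
    by blast
qed

lemma orthogonal_subgroupD:
  fixes \<Gamma> :: "('a::euclidean_space \<Rightarrow> 'a) set"
  assumes "subgroup \<Gamma> orthogonal_group"
  shows "\<And>g. g \<in> \<Gamma> \<Longrightarrow> orthogonal_transformation g" "id \<in> \<Gamma>"
    "\<And>g k. g \<in> \<Gamma> \<Longrightarrow> k \<in> \<Gamma> \<Longrightarrow> g \<circ> k \<in> \<Gamma>"
  using subgroup.subset[OF assms] subgroup.one_closed[OF assms] subgroup.m_closed[OF assms]
  by (auto simp: orthogonal_group_def)

lemma transcendence_degree_invariant_ring:
  fixes \<Gamma> :: "('a::euclidean_space \<Rightarrow> 'a) set"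
  assumes "subgroup \<Gamma> orthogonal_group" "finite \<Gamma>"
  shows "has_transcendence_degree (fraction_field (invariant_ring \<Gamma>)) DIM('a)"
proof -
  note \<Gamma> = orthogonal_subgroupD[OF assms(1)]
  obtain p F where "\<And>b. F b \<in> invariant_ring \<Gamma>" "\<And>b. ev (F b) p = 0" "\<And>b. grad (F b) p = b"
    using invariant_local_coordinates[OF assms(2) \<Gamma>] by blast
  moreover have "1 \<in> invariant_ring \<Gamma>"
    by (simp add: invariant_ring_def)
  ultimately show ?thesis
    using transcendence_degree_from_coordinates by blast
qed


section \<open>The symmetry group of a maximal Laplacian algebra of full transcendence degree\<close>

lemma subspace_gradients:
  assumes "subalgebra A"
  shows "subspace {grad f p | f. f \<in> A}"
proof -
  note alg = subalgebraD[OF assms]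
  show ?thesis
    unfolding subspace_def
  proof (intro conjI ballI allI)
    show "0 \<in> {grad f p | f. f \<in> A}"
      using alg(4) grad_zero[of p] by (metis (mono_tags, lifting) mem_Collect_eq)
  next
    fix u v assume "u \<in> {grad f p | f. f \<in> A}" "v \<in> {grad f p | f. f \<in> A}"
    then obtain f h where "f \<in> A" "h \<in> A" "u = grad f p" "v = grad h p"
      by blast
    then show "u + v \<in> {grad f p | f. f \<in> A}"
      using alg(5) grad_add[of f h p] by (intro CollectI exI[of _ "f + h"]) auto
  next
    fix c :: real and u assume "u \<in> {grad f p | f. f \<in> A}"
    then obtain f where "f \<in> A" "u = grad f p"
      by blast
    then show "c *\<^sub>R u \<in> {grad f p | f. f \<in> A}"
      using alg(7) grad_scaleR[of c f p] by (intro CollectI exI[of _ "c *\<^sub>R f"]) auto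
  qed
qed

lemma regular_pointI:
  assumes "subalgebra A" "\<And>b. b \<in> Basis \<Longrightarrow> \<exists>f\<in>A. grad f p = b"
  shows "regular_point A p"
proof -
  have "Basis \<subseteq> {grad f p | f. f \<in> A}"
    using assms(2) by blast
  then have "span Basis \<subseteq> {grad f p | f. f \<in> A}"
    by (rule span_minimal[OF _ subspace_gradients[OF assms(1)]])
  then show ?thesis
    unfolding regular_point_def by (auto simp: subset_iff) metis
qed

text \<open>
  A relation of least degree for \<open>x\<close> over \<open>A\<close>: its formal derivative has smaller degree and coefficients in
  \<open>A\<close>, so it cannot vanish at \<open>x\<close>.
\<close>

lemma separable_relation:
  fixes A :: "'a::euclidean_space polyfun set"
  assumes A: "subalgebra A" and deg: "has_transcendence_degree (fraction_field A) DIM('a)"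
  shows "\<exists>C M. (\<forall>k. C k \<in> A) \<and> (\<Sum>k<Suc M. C k * x ^ k) = 0 \<and>
    (\<Sum>k<M. of_nat (Suc k) * C (Suc k) * x ^ k) \<noteq> 0"
proof -
  define rel where "rel M C \<longleftrightarrow> (\<forall>k. C k \<in> A) \<and> (\<exists>k<M. C k \<noteq> 0) \<and> (\<Sum>k<M. C k * x ^ k) = 0"
    for M and C :: "nat \<Rightarrow> 'a polyfun"
  have "\<exists>M C. rel M C"
    unfolding rel_def by (rule algebraic_over_full_transcendence_degree[OF A deg])
  (* M bounds the degree strictly and is minimal among the nontrivial relations *)
  then have ex: "\<exists>C. rel (LEAST M. \<exists>C. rel M C) C"
    by (rule LeastI_ex[of "\<lambda>M. \<exists>C. rel M C"])
  define M where "M = (LEAST M. \<exists>C. rel M C)"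
  obtain C where C: "rel M C"
    using ex by (auto simp: M_def)
  have minimal: "\<not> rel N E" if "N < M" for N E
    using not_less_Least that unfolding M_def by blast
  obtain N where N: "M = Suc N"
    using C by (cases M) (auto simp: rel_def)
  have "(\<Sum>k<N. of_nat (Suc k) * C (Suc k) * x ^ k) \<noteq> 0"
  proof
    assume zero: "(\<Sum>k<N. of_nat (Suc k) * C (Suc k) * x ^ k) = 0"
    define E where "E k = of_nat (Suc k) * C (Suc k)" for k
    have E: "E k = real (Suc k) *\<^sub>R C (Suc k)" for k
      by (simp add: E_def scaleR_polyfun_eq)
    have in_A: "E k \<in> A" for k
      unfolding E using C by (intro subalgebraD(7)[OF A]) (simp add: rel_def)
    have "\<not> rel N E"
      by (rule minimal) (simp add: N)
    moreover have "(\<Sum>k<N. E k * x ^ k) = 0"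
      using zero by (simp only: E_def)
    ultimately have "E k = 0" if "k < N" for k
      using in_A that unfolding rel_def by blast
    then have high: "C (Suc k) = 0" if "k < N" for k
      using that by (simp add: E)
    have "(\<Sum>k<Suc N. C k * x ^ k) = C 0 * x ^ 0 + (\<Sum>k<N. C (Suc k) * x ^ Suc k)"
      by (rule sum.lessThan_Suc_shift)
    then have "C 0 = 0"
      using C high by (simp add: rel_def N)
    have "C k = 0" if "k < M" for k
      using that high \<open>C 0 = 0\<close> by (cases k) (auto simp: N)
    then show False
      using C unfolding rel_def by blast
  qed
  moreover have "\<forall>k. C k \<in> A" "(\<Sum>k<Suc N. C k * x ^ k) = 0"
    using C unfolding rel_def N by blast+
  ultimately show ?thesis
    by blast
qed

text \<open>
  Differentiate the relation for the coordinate \<open>\<langle>b, x\<rangle>\<close> at \<open>p\<close>. The coefficient of \<open>b\<close> is the formal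
  derivative of the relation, which is nonzero at \<open>p\<close>, and all other terms are multiples of gradients of
  elements of \<open>A\<close>.
\<close>

lemma gradient_from_relation:
  fixes A :: "'a::euclidean_space polyfun set"
  assumes A: "subalgebra A" and C: "\<And>k. C k \<in> A" and rel: "(\<Sum>k<Suc M. C k * lin b ^ k) = 0"
    and p: "ev (\<Sum>k<M. of_nat (Suc k) * C (Suc k) * lin b ^ k) p \<noteq> 0"
  shows "\<exists>f\<in>A. grad f p = b"
proof -
  let ?q = "\<Sum>k<M. of_nat (Suc k) * C (Suc k) * lin b ^ k"
  define g where "g = (\<Sum>k<Suc M. ((b \<bullet> p) ^ k) *\<^sub>R C k)"
  have "g \<in> A"
    unfolding g_def by (intro subalgebra_sum[OF A] subalgebraD(7)[OF A] C)
  have D_g: "ev (D v g) p = - (b \<bullet> v) * ev ?q p" for v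
  proof -
    have shift: "(\<Sum>k<Suc M. C k * (of_nat k * lin b ^ (k - 1))) = ?q"
      unfolding sum.lessThan_Suc_shift by (simp add: mult_ac)
    have "D v (C k * lin b ^ k) = lin b ^ k * D v (C k) + of_real (b \<bullet> v) * (C k * (of_nat k * lin b ^ (k - 1)))" for k
      by (simp add: D_mult D_power algebra_simps)
    then have "0 = (\<Sum>k<Suc M. lin b ^ k * D v (C k))
        + of_real (b \<bullet> v) * (\<Sum>k<Suc M. C k * (of_nat k * lin b ^ (k - 1)))"
      using arg_cong[OF rel, of "D v"] by (simp only: D_sum D_const sum.distrib sum_distrib_left)
    then have "0 = (\<Sum>k<Suc M. lin b ^ k * D v (C k)) + of_real (b \<bullet> v) * ?q"
      by (simp only: shift)
    then have "ev ((\<Sum>k<Suc M. lin b ^ k * D v (C k)) + of_real (b \<bullet> v) * ?q) p = 0"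
      by (metis zero_polyfun.rep_eq)
    moreover have "ev (D v g) p = ev (\<Sum>k<Suc M. lin b ^ k * D v (C k)) p"
      by (simp add: g_def)
    ultimately show ?thesis
      by (simp del: ev_sum)
  qed
  have "grad ((- 1 / ev ?q p) *\<^sub>R g) p = b"
  proof (rule grad_eqI)
    fix v
    have "ev (D v ((- 1 / ev ?q p) *\<^sub>R g)) p = (- 1 / ev ?q p) * ev (D v g) p"
      by (simp del: ev_sum)
    also have "\<dots> = v \<bullet> b"
      unfolding D_g using p by (simp add: inner_commute del: ev_sum)
    finally show "ev (D v ((- 1 / ev ?q p) *\<^sub>R g)) p = v \<bullet> b" .
  qed
  moreover have "(- 1 / ev ?q p) *\<^sub>R g \<in> A"
    using \<open>g \<in> A\<close> by (rule subalgebraD(7)[OF A])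
  ultimately show ?thesis
    by blast
qed

lemma regular_where_nonzero:
  fixes A :: "'a::euclidean_space polyfun set"
  assumes A: "subalgebra A" and deg: "has_transcendence_degree (fraction_field A) DIM('a)"
  obtains J where "J \<noteq> 0" "\<And>p. ev J p \<noteq> 0 \<Longrightarrow> regular_point A p"
proof -
  have "\<exists>q. q \<noteq> 0 \<and> (\<forall>p. ev q p \<noteq> 0 \<longrightarrow> (\<exists>f\<in>A. grad f p = b))" for b :: 'a
  proof -
    obtain M C where "\<And>k. C k \<in> A" "(\<Sum>k<Suc M. C k * lin b ^ k) = 0"
      "(\<Sum>k<M. of_nat (Suc k) * C (Suc k) * lin b ^ k) \<noteq> 0"
      using separable_relation[OF A deg, of "lin b"] by blast
    then show ?thesis
      using gradient_from_relation[OF A, of C b M]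
      by (intro exI[of _ "\<Sum>k<M. of_nat (Suc k) * C (Suc k) * lin b ^ k"] conjI allI impI) blast+
  qed
  then obtain q where q: "\<And>b :: 'a. q b \<noteq> 0" "\<And>b p. ev (q b) p \<noteq> 0 \<Longrightarrow> \<exists>f\<in>A. grad f p = b"
    by metis
  define J where "J = (\<Prod>b\<in>Basis. q b)"
  show ?thesis
  proof (rule that[of J])
    show "J \<noteq> 0"
      by (simp add: J_def q)
    show "regular_point A p" if "ev J p \<noteq> 0" for p
      using that by (intro regular_pointI[OF A] q(2)) (simp add: J_def)
  qed
qed

text \<open>
  Since \<open>A\<close> is graded, it is stable under precomposition with dilations.
\<close>

lemma regular_point_dilation:
  fixes A :: "'a::euclidean_space polyfun set"
  assumes A: "laplacian_algebra A" and reg: "regular_point A (t *\<^sub>R p)" and t: "t \<noteq> 0"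
  shows "regular_point A p"
  unfolding regular_point_def
proof
  fix v
  note alg = laplacian_algebraD(1)[OF A]
  obtain f where f: "f \<in> A" "grad f (t *\<^sub>R p) = (1 / t) *\<^sub>R v"
    using reg unfolding regular_point_def by blast
  obtain N c where c: "\<And>k. homogeneous k (c k)" "f = (\<Sum>k\<le>N. c k)"
    using homogeneous_decomposition[of f] by blast
  have lin: "linear (\<lambda>x::'a. t *\<^sub>R x)"
    by (simp add: linear_scaleR)
  have "pullback (\<lambda>x. t *\<^sub>R x) f = (\<Sum>k\<le>N. t ^ k *\<^sub>R c k)"
    using c(1) by (intro polyfun_eqI) (simp add: lin c(2) homogeneous_def)
  also have "\<dots> \<in> A"
    using homogeneous_components_closed[OF A c(1), of "{..N}"] f(1) c(2)
    by (intro subalgebra_sum[OF alg] subalgebraD(7)[OF alg]) auto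
  finally have "pullback (\<lambda>x. t *\<^sub>R x) f \<in> A" .
  moreover have "grad (pullback (\<lambda>x. t *\<^sub>R x) f) p = v"
  proof (rule grad_eqI)
    fix u
    have "ev (D u f) (t *\<^sub>R p) = (u \<bullet> v) / t"
      by (simp add: f(2) flip: inner_grad)
    then show "ev (D u (pullback (\<lambda>x. t *\<^sub>R x) f)) p = u \<bullet> v"
      using t by (simp add: D_pullback[OF lin] lin D_dir_scaleR)
  qed
  ultimately show "\<exists>f\<in>A. grad f p = v"
    by blast
qed

text \<open>
  The points that are not regular form a cone, so each homogeneous component of a polynomial vanishing on
  them vanishes on them as well.
\<close>

lemma homogeneous_regular_where_nonzero:
  fixes A :: "'a::euclidean_space polyfun set"
  assumes A: "laplacian_algebra A" and deg: "has_transcendence_degree (fraction_field A) DIM('a)"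
  obtains m J where "homogeneous m J" "J \<noteq> 0" "\<And>p. ev J p \<noteq> 0 \<Longrightarrow> regular_point A p"
proof -
  obtain J where J: "J \<noteq> 0" "\<And>p. ev J p \<noteq> 0 \<Longrightarrow> regular_point A p"
    using regular_where_nonzero[OF laplacian_algebraD(1)[OF A] deg] by blast
  obtain N c where c: "\<And>k. homogeneous k (c k)" "J = (\<Sum>k\<le>N. c k)"
    using homogeneous_decomposition[of J] by blast
  obtain m where m: "m \<le> N" "c m \<noteq> 0"
    using J(1) c(2) by (metis atMost_iff sum.neutral)
  have "regular_point A p" if p: "ev (c m) p \<noteq> 0" for p
  proof (rule ccontr)
    assume sing: "\<not> regular_point A p"
    define P where "P = (\<Sum>k\<le>N. monom (ev (c k) p) k)"
    have "poly P t = ev J (t *\<^sub>R p)" for t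
      using c(1) by (simp add: P_def poly_sum poly_monom c(2) homogeneous_def mult.commute)
    then have "poly P t = 0" if "t \<noteq> 0" for t
      using J(2) sing regular_point_dilation[OF A _ that] by metis
    then have "- {0} \<subseteq> {t. poly P t = 0}"
      by auto
    moreover have "infinite (- {0::real})"
      by (simp add: infinite_UNIV_char_0)
    ultimately have "P = 0"
      using poly_roots_finite[of P] finite_subset by blast
    moreover have "coeff P m = ev (c m) p"
      using m(1) by (simp add: P_def coeff_sum)
    ultimately show False
      using p by simp
  qed
  with c(1) m(2) that show ?thesis
    by blast
qed

text \<open>
  The sum of the squares of all translates is invariant, and it is nonzero because over the reals no
  cancellation is possible. The points that are not regular are permuted by the symmetries, so every
  translate vanishes there.
\<close>

lemma symmetric_weight:
  fixes A :: "'a::euclidean_space polyfun set"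
  assumes A: "laplacian_algebra A" and deg: "has_transcendence_degree (fraction_field A) DIM('a)"
  obtains m w where "homogeneous m w" "w \<noteq> 0" "w \<in> invariant_ring (symmetry_group A)"
    "\<And>p. \<not> regular_point A p \<Longrightarrow> ev w p = 0" "finite (symmetry_group A)"
proof -
  let ?G = "symmetry_group A"
  obtain m J where J: "homogeneous m J" "J \<noteq> 0" "\<And>p. ev J p \<noteq> 0 \<Longrightarrow> regular_point A p"
    using homogeneous_regular_where_nonzero[OF A deg] by blast
  obtain p0 where p0: "ev J p0 \<noteq> 0"
    using J(2) by (rule polyfun_nonzeroE)
  have fin: "finite ?G"
    using finite_symmetry_group[OF A J(3)[OF p0]] .
  note G = orthogonal_subgroupD[OF subgroup_symmetry_group[of A]]
  have lin: "linear g" if "g \<in> ?G" for g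
    using G(1)[OF that] by (rule orthogonal_transformation_linearI)
  define w where "w = (\<Sum>g\<in>?G. (pullback g J)\<^sup>2)"
  have ev_w: "ev w x = (\<Sum>g\<in>?G. (ev J (g x))\<^sup>2)" for x
    by (simp add: w_def lin)
  have "homogeneous (m + m) w"
    unfolding w_def power2_eq_square
  proof (intro homogeneous_sum homogeneous_mult)
    fix g assume "g \<in> ?G"
    then show "homogeneous m (pullback g J)" "homogeneous m (pullback g J)"
      using J(1) by (simp_all add: homogeneous_def lin linear_cmul)
  qed
  moreover have "w \<noteq> 0"
  proof
    assume "w = 0"
    then have "(\<Sum>g\<in>?G. (ev J (g p0))\<^sup>2) = 0"
      using ev_w[of p0] by simp
    then have "\<forall>g\<in>?G. ev J (g p0) = 0"
      using fin by (simp add: sum_nonneg_eq_0_iff)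
    from bspec[OF this G(2)] p0 show False
      by simp
  qed
  moreover have "w \<in> invariant_ring ?G"
    unfolding invariant_ring_def
  proof (intro CollectI ballI allI)
    fix k x assume k: "k \<in> ?G"
    have "(\<Sum>g\<in>?G. (ev J ((g \<circ> k) x))\<^sup>2) = (\<Sum>g\<in>?G. (ev J (g x))\<^sup>2)"
      by (rule sum_translate_closed[OF fin G(3) k orthogonal_transformation_surj[OF G(1)[OF k]]])
    then show "ev w (k x) = ev w x"
      by (simp add: ev_w)
  qed
  moreover have "ev w p = 0" if sing: "\<not> regular_point A p" for p
  proof -
    have "ev J (g p) = 0" if "g \<in> ?G" for g
    proof (rule ccontr)
      assume "ev J (g p) \<noteq> 0"
      then have "regular_point A (g p)"
        by (rule J(3))
      then have "regular_point A p"
        by (rule regular_point_transfer[OF A]) (rule ev_symmetry[OF that])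
      with sing show False by blast
    qed
    then show ?thesis
      by (simp add: ev_w)
  qed
  ultimately show ?thesis
    using fin that by blast
qed

text \<open>
  For a homogeneous invariant \<open>f\<close>, the product \<open>w f\<close> with the symmetric weight is constant on every fibre of
  \<open>A\<close> in the sphere: regular fibres are orbits, and on the others \<open>w\<close> vanishes. Maximality puts \<open>w f\<close> into
  \<open>A\<close>, and, with \<open>f = 1\<close>, also \<open>w\<close>; division then gives \<open>f \<in> A\<close>.
\<close>

lemma maximal_laplacian_algebra_is_invariant_ring:
  fixes A :: "'a::euclidean_space polyfun set"
  assumes max: "maximal_algebra A" and A: "laplacian_algebra A"
    and deg: "has_transcendence_degree (fraction_field A) DIM('a)"
  shows "finite (symmetry_group A)" "A = invariant_ring (symmetry_group A)"
proof -
  let ?B = "invariant_ring (symmetry_group A)"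
  obtain m w where w: "homogeneous m w" "w \<noteq> 0" "w \<in> ?B"
    "\<And>p. \<not> regular_point A p \<Longrightarrow> ev w p = 0" and fin: "finite (symmetry_group A)"
    using symmetric_weight[OF A deg] by blast
  show "finite (symmetry_group A)" by (rule fin)
  have B: "laplacian_algebra ?B"
    by (rule laplacian_algebra_invariant_ring) (simp add: symmetry_group_def)
  have weighted: "w * f \<in> A" if f: "homogeneous d f" "f \<in> ?B" for d f
  proof (rule ccontr)
    assume "w * f \<notin> A"
    then obtain p q where pq: "sphere_equiv A p q" "ev (w * f) p \<noteq> ev (w * f) q"
      using max homogeneous_mult[OF w(1) f(1)] unfolding maximal_algebra_def by blast
    have same: "ev f p = ev f q" if "f \<in> A" for f
      using pq(1) that by (simp add: sphere_equiv_def)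
    show False
    proof (cases "regular_point A p")
      case True
      obtain g where "g \<in> symmetry_group A" "g p = q"
        using regular_fibre[OF A True same] by blast
      then have "ev h q = ev h p" if "h \<in> ?B" for h
        using that by (auto simp: invariant_ring_def)
      then show False
        using pq(2) w(3) f(2) by simp
    next
      case False
      then have "\<not> regular_point A q"
        using regular_point_transfer[OF A, of q p] same by force
      with False show False
        using pq(2) w(4) by simp
    qed
  qed
  have "w * 1 \<in> A"
    by (rule weighted[of 0]) (auto simp: homogeneous_def invariant_ring_def)
  then have "w \<in> A" by simp
  have hom: "f \<in> A" if "homogeneous d f" "f \<in> ?B" for d f
    using laplacian_algebra_division[OF A \<open>w \<in> A\<close> w(1,2) that(1) weighted[OF that]] .
  show "A = ?B"
  proof
    show "A \<subseteq> ?B"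
      using ev_symmetry by (fastforce simp: invariant_ring_def)
    show "?B \<subseteq> A"
    proof
      fix f assume f: "f \<in> ?B"
      obtain N c where c: "\<And>k. homogeneous k (c k)" "f = (\<Sum>k\<le>N. c k)"
        using homogeneous_decomposition[of f] by blast
      have "c k \<in> ?B" if "k \<le> N" for k
        using homogeneous_components_closed[OF B c(1), of "{..N}" k] f c(2) that by simp
      then show "f \<in> A"
        unfolding c(2) using hom[OF c(1)] laplacian_algebraD(1)[OF A]
        by (intro subalgebra_sum) auto
    qed
  qed
qed

theorem theoremB:
  fixes A :: "'a::euclidean_space polyfun set"
  assumes "subalgebra A"
  shows "(\<exists>\<Gamma>. subgroup \<Gamma> orthogonal_group \<and> finite \<Gamma> \<and> A = invariant_ring \<Gamma>) \<longleftrightarrow>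
    maximal_algebra A \<and> laplacian_algebra A \<and>
    has_transcendence_degree (fraction_field A) DIM('a)"
proof
  assume "\<exists>\<Gamma>. subgroup \<Gamma> orthogonal_group \<and> finite \<Gamma> \<and> A = invariant_ring \<Gamma>"
  then obtain \<Gamma> where \<Gamma>: "subgroup \<Gamma> orthogonal_group" "finite \<Gamma>" and A: "A = invariant_ring \<Gamma>"
    by blast
  note orth = orthogonal_subgroupD(1)[OF \<Gamma>(1)]
  show "maximal_algebra A \<and> laplacian_algebra A \<and>
      has_transcendence_degree (fraction_field A) DIM('a)"
    unfolding A using maximal_algebra_invariant_ring[OF orth] laplacian_algebra_invariant_ring[OF orth]
      transcendence_degree_invariant_ring[OF \<Gamma>] by blast
next
  assume "maximal_algebra A \<and> laplacian_algebra A \<and>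
      has_transcendence_degree (fraction_field A) DIM('a)"
  then show "\<exists>\<Gamma>. subgroup \<Gamma> orthogonal_group \<and> finite \<Gamma> \<and> A = invariant_ring \<Gamma>"
    using maximal_laplacian_algebra_is_invariant_ring[of A] subgroup_symmetry_group[of A] by blast
qed

end
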